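(* Let $K>0$ and let $\mu_0\in\mathcal M([0,2\pi)\times\mathbb R)$ be a probability measure. Suppose that the oscillators are identical, with common natural frequency normalized to zero (i.e. the $\Omega$-projection of $\mathrm{spt}(\mu_0)$ is a single point and $\Omega_c(0)=\langle\mu_0,\Omega\rangle=0$), and that $$\theta_c(0)=\langle \mu_0,\theta\rangle=\pi,\qquad D_\theta(\mu_0)<\pi .$$ Let $\mu_t$, $t\ge 0$, be the measure valued solution to the kinetic Kuramoto equation with coupling strength $K$ and initial datum $\mu_0$, and set $$\mu_\infty(d\theta,d\Omega):=\delta_{\theta_c(0)}(\theta)\otimes\delta_{\Omega_c(0)}(\Omega).$$ Then $$\lim_{t\to\infty} d(\mu_t,\mu_\infty)=0,$$ where $d$ is the bounded Lipschitz distance.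
   Context: The interval $[0,2\pi)$ is used to denote the circle $\mathbb T=\mathbb R/2\pi\mathbb Z$. $\mathcal M([0,2\pi)\times\mathbb R)$ is the set of nonnegative Radon measures on $[0,2\pi)\times\mathbb R$, and $\langle\nu,h\rangle:=\int_0^{2\pi}\int_{\mathbb R}h(\theta,\Omega)\,\nu(d\theta,d\Omega)$. In $\langle\nu,\theta\rangle$ the function $\theta$ takes its values in $[0,2\pi)\subset\mathbb R$. The kinetic Kuramoto equation with coupling strength $K$ is $$\partial_t f+\partial_\theta(\omega[f]f)=0,\quad \omega[f](\theta,\Omega,t)=\Omega-K\int_{\mathbb T}\sin(\theta-\theta_* )\rho(\theta_*,t)\,d\theta_*,\quad \rho(\theta_*,t)=\int_{\mathbb R}f(\theta_*,\Omega_*,t)\,d\Omega_*.$$ Measure valued solution: $\mu\in L^\infty([0,T);\mathcal M([0,2\pi)\times\mathbb R))$ is a measure valued solution on $[0,T)$ with initial datum $\mu_0$ if (1) $t\mapsto\langle\mu_t,h\rangle$ is continuous for all $h\in \mathcal C_0([0,2\pi)\times\mathbb R)$; (2) for all $h\in \mathcal C_0^1([0,2\pi)\times\mathbb R\times[0,T))$ (test functions on the circle times $\mathbb R$, i.e. $2\pi$-periodic in $\theta$) and all $t\in[0,T)$, $$\langle\mu_t,h(\cdot,\cdot,t)\rangle-\langle\mu_0,h(\cdot,\cdot,0)\rangle=\int_0^t\langle\mu_s,\partial_s h+\omega[\mu]\partial_\theta h\rangle\,ds,$$ where $\omega[\mu](\theta,\Omega,s)=\Omega-K\int_0^{2\pi}\int_{\mathbb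 R}\sin(\theta-\theta_* )\,\mu_s(d\theta_*,d\Omega_* )$. Solutions on $[0,\infty)$ are understood as solutions on $[0,T)$ for every $T>0$; the measure valued solution with a given initial datum is unique. $D_\theta(\mu_t)$ is the diameter (in $[0,2\pi)\subset\mathbb R$) of the $\theta$-projection of $\mathrm{spt}(\mu_t)$. Bounded Lipschitz distance: $d(\mu,\nu)=\sup_{h\in\mathcal S}|\langle\mu,h\rangle-\langle\nu,h\rangle|$, where $\mathcal S$ is the set of $h:[0,2\pi)\times\mathbb R\to\mathbb R$ with $\|h\|_{L^\infty}\le1$ and $\mathrm{Lip}(h)\le1$, with $\mathrm{Lip}(h)=\sup_{z_1\ne z_2}|h(z_1)-h(z_2)|/|z_1-z_2|$ (Euclidean distance). *)

theory Defs
  imports "HOL-Probability.Probability"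
begin

text \<open>
  The phase space is the product of the circle and the real line. The circle is represented by
  its fundamental domain \<open>{0..<2 * pi}\<close>; points are pairs of a phase and a natural frequency.
\<close>

definition circle :: "real set" where
  "circle = {0..<2 * pi}"

definition phase_space :: "(real \<times> real) set" where
  "phase_space = circle \<times> UNIV"

text \<open>
  The topology of the phase space is that of the circle times the line, not the one inherited
  from the plane; it is the topology pulled back along the map below. Both topologies
  have the same Borel sets.
\<close>

definition embed :: "real \<times> real \<Rightarrow> complex \<times> real" where
  "embed z = (cis (fst z), snd z)"

text \<open>
  Every Borel measure that is finite on compact sets is Radon on this space. As the circle is
  compact, it suffices to consider the sets \<open>circle \<times> C\<close> with compact \<open>C\<close>.
\<close>

definition radon_measures :: "(real \<times> real) measure set" where
  "radon_measures = {M. sets M = sets (restrict_space borel phase_space) \<and>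
     (\<forall>C. compact C \<longrightarrow> emeasure M (circle \<times> C) < \<infinity>)}"

definition spt :: "(real \<times> real) measure \<Rightarrow> (real \<times> real) set" where
  "spt M = {z \<in> phase_space.
     \<forall>U. open U \<and> embed z \<in> U \<longrightarrow> emeasure M {w \<in> phase_space. embed w \<in> U} > 0}"

definition D_theta :: "(real \<times> real) measure \<Rightarrow> real" where
  "D_theta M = diameter (fst ` spt M)"

definition theta_c :: "(real \<times> real) measure \<Rightarrow> real" where
  "theta_c M = (LINT z|M. fst z)"

definition Omega_c :: "(real \<times> real) measure \<Rightarrow> real" where
  "Omega_c M = (LINT z|M. snd z)"

text \<open>
  Test functions on the circle are functions on the line that are periodic in the phase.
  The index 0 stands for compact support; the compact circle factor imposes no condition.
\<close>

definition C0 :: "(real \<times> real \<Rightarrow> real) set" where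
  "C0 = {h. continuous_on UNIV h \<and>
     (\<forall>\<theta> \<Omega>. h (\<theta> + 2 * pi, \<Omega>) = h (\<theta>, \<Omega>)) \<and>
     (\<exists>C. compact C \<and> (\<forall>\<theta> \<Omega>. \<Omega> \<notin> C \<longrightarrow> h (\<theta>, \<Omega>) = 0))}"

definition C01 :: "real \<Rightarrow> (real \<times> real \<times> real \<Rightarrow> real) set" where
  "C01 T = {h.
     (\<exists>h' :: real \<times> real \<times> real \<Rightarrow> (real \<times> real \<times> real) \<Rightarrow>\<^sub>L real.
        continuous_on (UNIV \<times> UNIV \<times> {0..<T}) h' \<and>
        (\<forall>z \<in> UNIV \<times> UNIV \<times> {0..<T}.
           (h has_derivative blinfun_apply (h' z)) (at z within UNIV \<times> UNIV \<times> {0..<T}))) \<and>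
     (\<forall>\<theta> \<Omega>. \<forall>s \<in> {0..<T}. h (\<theta> + 2 * pi, \<Omega>, s) = h (\<theta>, \<Omega>, s)) \<and>
     (\<exists>C. compact C \<and> C \<subseteq> UNIV \<times> {0..<T} \<and>
        (\<forall>\<theta> \<Omega>. \<forall>s \<in> {0..<T}. (\<Omega>, s) \<notin> C \<longrightarrow> h (\<theta>, \<Omega>, s) = 0))}"

definition d_theta :: "(real \<times> real \<times> real \<Rightarrow> real) \<Rightarrow> real \<Rightarrow> real \<Rightarrow> real \<Rightarrow> real" where
  "d_theta h \<theta> \<Omega> s = vector_derivative (\<lambda>x. h (x, \<Omega>, s)) (at \<theta>)"

text \<open>One-sided at time 0, since test functions live on times \<open>{0..<T}\<close> only.\<close>

definition d_time ::
    "real \<Rightarrow> (real \<times> real \<times> real \<Rightarrow> real) \<Rightarrow> real \<Rightarrow> real \<Rightarrow> real \<Rightarrow> real" where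
  "d_time T h \<theta> \<Omega> s = vector_derivative (\<lambda>r. h (\<theta>, \<Omega>, r)) (at s within {0..<T})"

definition velocity :: "real \<Rightarrow> (real \<times> real) measure \<Rightarrow> real \<Rightarrow> real \<Rightarrow> real" where
  "velocity K M \<theta> \<Omega> = \<Omega> - K * (LINT z|M. sin (\<theta> - fst z))"

text \<open>
  The first two conditions say that \<open>\<mu>\<close> is essentially bounded in total mass; its weak
  measurability in time is a consequence of the continuity condition.
\<close>

definition measure_valued_solution ::
    "real \<Rightarrow> real \<Rightarrow> (real \<times> real) measure \<Rightarrow> (real \<Rightarrow> (real \<times> real) measure) \<Rightarrow> bool" where
  "measure_valued_solution K T \<mu>0 \<mu> \<longleftrightarrow>
     (\<forall>t \<in> {0..<T}. \<mu> t \<in> radon_measures) \<and>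
     (\<exists>C. AE t in lborel. t \<in> {0..<T} \<longrightarrow> emeasure (\<mu> t) phase_space \<le> ennreal C) \<and>
     (\<forall>h \<in> C0. continuous_on {0..<T} (\<lambda>t. LINT z|\<mu> t. h z)) \<and>
     (\<forall>h \<in> C01 T. \<forall>t \<in> {0..<T}.
        (LINT (\<theta>, \<Omega>)|\<mu> t. h (\<theta>, \<Omega>, t)) - (LINT (\<theta>, \<Omega>)|\<mu>0. h (\<theta>, \<Omega>, 0)) =
        (LBINT s=0..t. (LINT (\<theta>, \<Omega>)|\<mu> s.
           d_time T h \<theta> \<Omega> s + velocity K (\<mu> s) \<theta> \<Omega> * d_theta h \<theta> \<Omega> s)))"

definition global_measure_valued_solution ::
    "real \<Rightarrow> (real \<times> real) measure \<Rightarrow> (real \<Rightarrow> (real \<times> real) measure) \<Rightarrow> bool" where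
  "global_measure_valued_solution K \<mu>0 \<mu> \<longleftrightarrow> (\<forall>T>0. measure_valued_solution K T \<mu>0 \<mu>)"

text \<open>
  The Lipschitz condition refers to the Euclidean distance on the fundamental domain, so the
  functions need not be periodic. The supremum is bounded by the sum of the total masses,
  hence meaningful for finite measures.
\<close>

definition bounded_lipschitz_dist ::
    "(real \<times> real) measure \<Rightarrow> (real \<times> real) measure \<Rightarrow> real" where
  "bounded_lipschitz_dist M N =
     (SUP h \<in> {h. (\<forall>z \<in> phase_space. \<bar>h z\<bar> \<le> 1) \<and> 1-lipschitz_on phase_space h}.
        \<bar>(LINT z|M. h z) - (LINT z|N. h z)\<bar>)"

definition mu_infinity :: "(real \<times> real) measure \<Rightarrow> (real \<times> real) measure" where
  "mu_infinity M =
     return (restrict_space borel circle) (theta_c M) \<Otimes>\<^sub>M return borel (Omega_c M)"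

end

theory Submission imports Defs begin

text \<open>
  Testing with functions of the frequency alone shows that \<open>\<mu> t\<close> is a probability measure carried by
  frequency zero, so only the phase marginals matter, and they solve a transport equation with
  velocity \<open>- K * (LINT y|\<nu> t. sin (x - y))\<close>. Let the initial phases lie in an arc with centre
  \<open>c\<close> and half-width \<open>\<delta> < pi / 2\<close>. The average of a penalty that grows quadratically outside the arc
  satisfies a linear differential inequality, since the velocity points inwards up to an error
  controlled by the mass outside; by Gronwall the arc is never left. On the arc the phase
  coincides with a smooth periodic function, hence its mean \<open>pi\<close> is conserved by the antisymmetry of
  the sine, and as \<open>u * sin u \<ge> r * u\<^sup>2\<close> for \<open>\<bar>u\<bar> \<le> 2 * \<delta> < pi\<close> its variance decays exponentially.
  The bounded Lipschitz distance to the Dirac measure is at most the standard deviation.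
\<close>

section \<open>Analytic preliminaries\<close>

text \<open>The tests in the weak equation only have to be continuously differentiable, so the
  squared positive part is smooth enough to build the cut-offs and penalties below.\<close>

definition pos_sq :: "real \<Rightarrow> real" where
  "pos_sq x = (max 0 x)\<^sup>2"

lemma has_real_derivative_pos_sq: "(pos_sq has_real_derivative 2 * max 0 x) (at x)"
proof -
  consider "x < 0" | "x > 0" | "x = 0" by linarith
  then show ?thesis
  proof cases
    case 1
    have "((\<lambda>_. 0) has_real_derivative 2 * max 0 x) (at x)"
      using 1 by (auto intro!: derivative_eq_intros)
    then show ?thesis
      by (rule has_field_derivative_transform_within_open[where S = "{..<0}"])
        (use 1 in \<open>auto simp: pos_sq_def\<close>)
  next
    case 2
    have "((\<lambda>y. y\<^sup>2) has_real_derivative 2 * max 0 x) (at x)"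
      using 2 by (auto intro!: derivative_eq_intros)
    then show ?thesis
      by (rule has_field_derivative_transform_within_open[where S = "{0<..}"])
        (use 2 in \<open>auto simp: pos_sq_def\<close>)
  next
    case 3
    have "((\<lambda>h. max 0 h) \<longlongrightarrow> max 0 (0::real)) (at 0)"
      by (intro tendsto_intros)
    then have "((\<lambda>h. max 0 h) \<longlongrightarrow> (0::real)) (at 0)" by simp
    then have "((\<lambda>h. (pos_sq (0 + h) - pos_sq 0) / h) \<longlongrightarrow> 0) (at 0)"
      by (rule Lim_transform_eventually)
        (auto simp: eventually_at_filter pos_sq_def max_def power2_eq_square)
    then show ?thesis using 3 by (simp add: DERIV_def)
  qed
qed

lemmas DERIV_pos_sq [derivative_intros] = DERIV_chain2[OF has_real_derivative_pos_sq]

lemma continuous_on_pos_sq [continuous_intros]: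
  "continuous_on A f \<Longrightarrow> continuous_on A (\<lambda>x. pos_sq (f x))"
  unfolding pos_sq_def by (intro continuous_intros)

lemma pos_sq_nonneg [simp]: "0 \<le> pos_sq x"
  by (simp add: pos_sq_def)

lemma pos_sq_eq_0 [simp]: "x \<le> 0 \<Longrightarrow> pos_sq x = 0"
  by (simp add: pos_sq_def)

text \<open>Gronwall: \<open>u t * exp (- c * t)\<close> does not increase. The derivative is asked
  for at positive times, the endpoint being covered by continuity. The rate \<open>c\<close> will be
  positive for the support and negative for the variance.\<close>

lemma exp_bound_of_derivative_le:
  fixes u u' :: "real \<Rightarrow> real"
  assumes cont: "continuous_on {0..} u"
    and deriv: "\<And>t. 0 < t \<Longrightarrow> (u has_real_derivative u' t) (at t)"
    and le: "\<And>t. 0 < t \<Longrightarrow> u' t \<le> c * u t"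
    and "0 \<le> t"
  shows "u t \<le> u 0 * exp (c * t)"
proof -
  have "u t * exp (- c * t) \<le> u 0 * exp (- c * 0)"
  proof (rule DERIV_nonpos_imp_decreasing_open[OF \<open>0 \<le> t\<close>])
    fix x assume "0 < x" "x < t"
    have "((\<lambda>t. u t * exp (- c * t)) has_real_derivative (u' x - c * u x) * exp (- c * x)) (at x)"
      by (rule derivative_eq_intros deriv \<open>0 < x\<close> refl | simp add: algebra_simps)+
    moreover have "(u' x - c * u x) * exp (- c * x) \<le> 0"
      using le[OF \<open>0 < x\<close>] by (intro mult_nonpos_nonneg) auto
    ultimately show "\<exists>y. ((\<lambda>t. u t * exp (- c * t)) has_real_derivative y) (at x) \<and> y \<le> 0"
      by blast
  next
    show "continuous_on {0..t} (\<lambda>t. u t * exp (- c * t))"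
      by (intro continuous_intros continuous_on_subset[OF cont]) auto
  qed
  then show ?thesis
    by (simp add: exp_minus field_simps)
qed

lemma (in prob_space) expectation_square_ge:
  fixes X :: "'a \<Rightarrow> real"
  assumes "integrable M X" "integrable M (\<lambda>x. (X x)\<^sup>2)"
  shows "(expectation X)\<^sup>2 \<le> expectation (\<lambda>x. (X x)\<^sup>2)"
  using variance_eq[OF assms] variance_positive[of X] by simp

text \<open>The phase \<open>x - pi\<close> jumps on the circle and cannot serve as a test. On an
  arc that stays away from the jump, \<open>F\<close> replaces it by a periodic, continuously
  differentiable function.\<close>

lemma angle_function_exists:
  assumes "0 < E" "E < pi"
  obtains F F' :: "real \<Rightarrow> real" where
    "\<And>x. (F has_real_derivative F' x) (at x)" "continuous_on UNIV F'"
    "\<And>x. F (x + 2 * pi) = F x"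
    "\<And>x. \<bar>x - pi\<bar> < E \<Longrightarrow> F x = x - pi" "\<And>x. \<bar>x - pi\<bar> < E \<Longrightarrow> F' x = 1"
proof -
  \<comment> \<open>The half-angle formula \<open>tan (u / 2) = sin u / (1 + cos u)\<close> with \<open>u = x - pi\<close>, its denominator
    modified near \<open>cos x = 1\<close> so as to stay positive.\<close>
  define psi where "psi x = 1 - cos x + pos_sq (cos E + cos x)" for x
  define psi' where "psi' x = sin x - 2 * max 0 (cos E + cos x) * sin x" for x
  define F where "F x = 2 * arctan (- sin x / psi x)" for x
  define F' where "F' x = 2 * (((- cos x) * psi x - (- sin x) * psi' x) / (psi x * psi x)
    / (1 + (- sin x / psi x)\<^sup>2))" for x
  have psi_pos: "psi x > 0" for x
  proof (cases "cos x = 1")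
    case True
    have "cos E > cos pi"
      using assms by (subst cos_mono_less_eq) auto
    then show ?thesis
      using True by (simp add: psi_def pos_sq_def)
  next
    case False
    then have "cos x < 1" using cos_le_one[of x] by linarith
    then show ?thesis
      by (simp add: psi_def add_pos_nonneg)
  qed
  have psi_deriv: "(psi has_real_derivative psi' x) (at x)" for x
    unfolding psi_def psi'_def by (auto intro!: derivative_eq_intros)
  have F_deriv: "(F has_real_derivative F' x) (at x)" for x
    unfolding F_def F'_def
    by (rule derivative_eq_intros psi_deriv refl less_imp_neq[OF psi_pos, symmetric]
      | simp add: divide_inverse algebra_simps)+
  have one: "1 + (- sin x / psi x)\<^sup>2 \<noteq> 0" for x
    by (smt (verit) zero_le_power2)
  have cont_psi: "continuous_on UNIV psi" "continuous_on UNIV psi'"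
    unfolding psi_def psi'_def by (intro continuous_intros)+
  have F'_cont: "continuous_on UNIV F'"
    unfolding F'_def using one psi_pos less_imp_neq[OF psi_pos]
    by (intro continuous_intros cont_psi) (auto simp: less_imp_neq[OF psi_pos, symmetric])
  have F_eq: "F x = x - pi" if "\<bar>x - pi\<bar> < E" for x
  proof -
    define u where "u = x - pi"
    have u: "\<bar>u\<bar> < E" "x = u + pi" using that by (auto simp: u_def)
    have "cos \<bar>u\<bar> > cos E"
      using u assms by (subst cos_mono_less_eq) auto
    \<comment> \<open>Since \<open>cos x = - cos u\<close>, the correction in \<open>psi\<close>
      vanishes here.\<close>
    then have "cos u > cos E" by simp
    then have "F x = 2 * arctan (sin u / (cos u + 1))"
      by (simp add: F_def psi_def u add.commute)
    also have "sin u / (cos u + 1) = tan (u / 2)"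
      using tan_half[of "u / 2"] by simp
    also have "arctan (tan (u / 2)) = u / 2"
      using u assms by (intro arctan_tan) auto
    finally show ?thesis by (simp add: u_def)
  qed
  have "F' x = 1" if "\<bar>x - pi\<bar> < E" for x
  proof (rule DERIV_unique[OF F_deriv])
    have "((\<lambda>x. x - pi) has_real_derivative 1) (at x)"
      by (auto intro!: derivative_eq_intros)
    then show "(F has_real_derivative 1) (at x)"
      by (rule has_field_derivative_transform_within_open[where S = "{pi - E<..<pi + E}"])
        (use that in \<open>auto simp: F_eq\<close>)
  qed
  moreover have "F (x + 2 * pi) = F x" for x
    by (simp add: F_def psi_def)
  ultimately show ?thesis
    using that[of F F'] F_deriv F'_cont F_eq by blast
qed

text \<open>The pull of an oscillator inside the arc \<open>\<kappa> \<le> cos x\<close> on one outside is directed inwards; so only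
  pairs of oscillators that are both outside contribute to the right-hand side.\<close>

lemma kernel_bound:
  fixes \<kappa> \<alpha> \<beta> :: real
  assumes "0 < \<kappa>" "\<kappa> < 1"
  defines "p \<equiv> \<lambda>x. max 0 (\<kappa> - cos x)"
  shows "- sin (\<alpha> - \<beta>) * (sin \<alpha> * (p \<alpha> * max 0 (\<kappa>\<^sup>2 - (p \<alpha>)\<^sup>2)))
    \<le> (1 + \<kappa> / sqrt (1 - \<kappa>\<^sup>2)) * (p \<alpha> * p \<beta>)"
proof -
  \<comment> \<open>\<open>\<kappa>\<close> and \<open>\<sigma>\<close> are the cosine and sine of
    the half-width of the arc.\<close>
  define \<sigma> where "\<sigma> = sqrt (1 - \<kappa>\<^sup>2)"
  have k2: "\<kappa>\<^sup>2 < 1" using assms by (simp add: power_less_one_iff)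
  have \<sigma>: "\<sigma> > 0" "\<sigma>\<^sup>2 = 1 - \<kappa>\<^sup>2" using k2 by (auto simp: \<sigma>_def)
  have p0: "p x \<ge> 0" for x by (simp add: p_def)
  define L where "L = 1 + \<kappa> / \<sigma>"
  have L: "L \<ge> 0" using \<sigma> assms by (simp add: L_def)
  define w where "w = max 0 (\<kappa>\<^sup>2 - (p \<alpha>)\<^sup>2)"
  have w: "0 \<le> w" "w \<le> 1"
    using k2 by (auto simp: w_def) (smt (verit) zero_le_power2)
  \<comment> \<open>This range is all that counts: \<open>p \<alpha>\<close> vanishes for
    \<open>\<kappa> \<le> cos \<alpha>\<close>, and the other factor for
    \<open>cos \<alpha> \<le> 0\<close>.\<close>
  have main: "- sin (\<alpha> - \<beta>) * sin \<alpha> \<le> L * p \<beta>" if "0 < cos \<alpha>" "cos \<alpha> < \<kappa>"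
  proof -
    define A B a b where "A = \<bar>sin \<alpha>\<bar>" and "B = \<bar>sin \<beta>\<bar>" and "a = cos \<alpha>" and "b = cos \<beta>"
    have AB: "A\<^sup>2 + a\<^sup>2 = 1" "B\<^sup>2 + b\<^sup>2 = 1" "0 \<le> A" "0 \<le> B" "A \<le> 1"
      by (auto simp: A_def B_def a_def b_def)
    have a: "0 < a" "a < \<kappa>" using that by (auto simp: a_def)
    have "a\<^sup>2 \<le> \<kappa>\<^sup>2" using a by (intro power_mono) auto
    then have "\<sigma>\<^sup>2 \<le> A\<^sup>2" using AB \<sigma> by linarith
    then have A: "\<sigma> \<le> A" using AB by (rule_tac power2_le_imp_le) auto
    have B: "B \<le> \<sigma> + \<kappa> / \<sigma> * p \<beta>"
    proof (cases "b \<ge> \<kappa>")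
      case True
      then have "\<kappa>\<^sup>2 \<le> b\<^sup>2" using assms by (intro power_mono) auto
      then have "B\<^sup>2 \<le> \<sigma>\<^sup>2" using AB \<sigma> by linarith
      then have "B \<le> \<sigma>" using \<sigma> by (rule_tac power2_le_imp_le) auto
      moreover have "\<kappa> / \<sigma> * p \<beta> \<ge> 0" using \<sigma> assms p0 by simp
      ultimately show ?thesis by linarith
    next
      case False
      \<comment> \<open>The unit disc lies below its tangent at \<open>(\<kappa>, \<sigma>)\<close>:
        the point \<open>(b, B)\<close> satisfies
        \<open>\<kappa> * b + \<sigma> * B \<le> 1\<close>.\<close>
      have "2 * (\<kappa> * b) \<le> \<kappa>\<^sup>2 + b\<^sup>2" "2 * (\<sigma> * B) \<le> \<sigma>\<^sup>2 + B\<^sup>2"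
        using sum_squares_bound[of \<kappa> b] sum_squares_bound[of \<sigma> B] by simp_all
      then have "\<sigma> * B \<le> \<sigma>\<^sup>2 + \<kappa> * (\<kappa> - b)" 
        using AB \<sigma> by (simp add: right_diff_distrib power2_eq_square[of \<kappa>, symmetric])
      then show ?thesis using False \<sigma>
        by (simp add: p_def b_def field_simps power2_eq_square)
    qed
    have "sin \<alpha> * sin \<beta> \<le> A * B"
      unfolding A_def B_def by (metis abs_ge_self abs_mult)
    then have "a * (sin \<alpha> * sin \<beta>) \<le> a * (A * B)"
      using a by (intro mult_left_mono) auto
    moreover have "- sin (\<alpha> - \<beta>) * sin \<alpha> = a * (sin \<alpha> * sin \<beta>) - A\<^sup>2 * b"
      by (simp add: sin_diff A_def a_def b_def algebra_simps power2_eq_square)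
    ultimately have "- sin (\<alpha> - \<beta>) * sin \<alpha> \<le> A * (a * B - A * b)"
      by (simp add: algebra_simps power2_eq_square)
    \<comment> \<open>If \<open>\<beta>\<close> is in the arc, then \<open>B \<le> \<sigma>\<close>
      and \<open>\<kappa> \<le> b\<close>, and \<open>a * \<sigma> \<le> \<kappa> * A\<close> gives
      the sign. Outside, the errors \<open>\<kappa> / \<sigma> * p \<beta>\<close> from
      \<open>B\<close> and \<open>p \<beta>\<close> from \<open>b\<close> add up to the constant
      \<open>L\<close>.\<close>
    also have "a * B - A * b \<le> L * p \<beta>"
    proof -
      have "a * B \<le> a * (\<sigma> + \<kappa> / \<sigma> * p \<beta>)" using B a by (intro mult_left_mono) auto
      moreover have "a * \<sigma> \<le> \<kappa> * A" using a A \<sigma> by (intro mult_mono) auto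
      moreover have "a * (\<kappa> / \<sigma> * p \<beta>) \<le> 1 * (\<kappa> / \<sigma> * p \<beta>)"
        using a assms \<sigma> p0 by (intro mult_right_mono) auto
      moreover have "A * (\<kappa> - p \<beta>) \<le> A * b"
        using AB by (intro mult_left_mono) (auto simp: p_def b_def)
      moreover have "A * p \<beta> \<le> 1 * p \<beta>"
        using AB p0 by (intro mult_right_mono) auto
      ultimately show ?thesis
        unfolding L_def by (simp add: algebra_simps)
    qed
    then have "A * (a * B - A * b) \<le> A * (L * p \<beta>)" using AB by (intro mult_left_mono) auto
    also have "\<dots> \<le> 1 * (L * p \<beta>)" using AB L p0 by (intro mult_right_mono) auto
    finally show ?thesis by simp
  qed
  have "- sin (\<alpha> - \<beta>) * sin \<alpha> * w * p \<alpha> \<le> L * p \<beta> * p \<alpha>"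
  proof (cases "p \<alpha> = 0 \<or> w = 0")
    case True then show ?thesis using L p0 by auto
  next
    case False
    then have "p \<alpha> > 0" using p0[of \<alpha>] by simp
    then have 1: "cos \<alpha> < \<kappa>" "p \<alpha> = \<kappa> - cos \<alpha>" by (auto simp: p_def)
    from False have "(p \<alpha>)\<^sup>2 < \<kappa>\<^sup>2" by (auto simp: w_def max_def split: if_splits)
    then have "p \<alpha> < \<kappa>" 
      by (rule power2_less_imp_less) (use assms(1) in simp)
    then have "0 < cos \<alpha>" using 1 by simp
    from main[OF this 1(1)] have "- sin (\<alpha> - \<beta>) * sin \<alpha> * w \<le> L * p \<beta> * w"
      using w by (intro mult_right_mono) auto
    also have "\<dots> \<le> L * p \<beta> * 1" using w L p0 by (intro mult_left_mono) auto
    finally show ?thesis using p0 by (intro mult_right_mono) auto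
  qed
  then show ?thesis by (simp add: w_def L_def \<sigma>_def mult_ac)
qed

lemma DERIV_imp_continuous_on:
  fixes g g' :: "real \<Rightarrow> real"
  shows "(\<And>x. (g has_real_derivative g' x) (at x)) \<Longrightarrow> continuous_on A g"
  by (meson DERIV_isCont continuous_at_imp_continuous_on)

text \<open>The continuous function \<open>sinc\<close> is positive on the compact interval
  \<open>{-R..R}\<close> because \<open>R < pi\<close>; its minimum there serves as
  \<open>r\<close>.\<close>

lemma sin_mult_ge:
  assumes "0 < R" "R < pi"
  obtains r where "0 < r" "\<And>u. \<bar>u\<bar> \<le> R \<Longrightarrow> r * u\<^sup>2 \<le> u * sin u"
proof -
  have "\<exists>x\<in>{-R..R}. \<forall>y\<in>{-R..R}. sinc x \<le> sinc y"
    using assms by (intro continuous_attains_inf continuous_intros) auto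
  then obtain x where x: "x \<in> {-R..R}" "\<And>y. y \<in> {-R..R} \<Longrightarrow> sinc x \<le> sinc y"
    by blast
  have "sinc x > 0"
  proof (cases "0 \<le> x")
    case True
    then show ?thesis using x(1) assms sin_gt_zero[of x] by auto
  next
    case False
    then show ?thesis using x(1) assms sin_gt_zero[of "- x"] by (auto intro: divide_neg_neg)
  qed
  moreover have "sinc x * u\<^sup>2 \<le> u * sin u" if "\<bar>u\<bar> \<le> R" for u
  proof -
    have "sinc x \<le> sinc u"
      by (rule x(2)) (use that in \<open>auto simp: abs_le_iff\<close>)
    then have "sinc x * u\<^sup>2 \<le> sinc u * u\<^sup>2"
      by (rule mult_right_mono) simp
    also have "\<dots> = u * sin u" by (simp add: power2_eq_square)
    finally show ?thesis .
  qed
  ultimately show ?thesis using that by blast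
qed

section \<open>Concentration of the phases\<close>

text \<open>Functions such as \<open>\<bar>x - pi\<bar>\<close>, which are not periodic, will be
  integrated too; boundedness comes from the compact closure \<open>{0..2 * pi}\<close> of the
  fundamental domain.\<close>

lemma integrable_continuous_circle:
  fixes g :: "real \<Rightarrow> real"
  assumes "prob_space M" "sets M = sets borel" "AE x in M. x \<in> circle" "continuous_on UNIV g"
  shows "integrable M g"
proof -
  interpret prob_space M by fact
  have "compact (g ` {0..2 * pi})"
    by (intro compact_continuous_image compact_Icc continuous_on_subset[OF assms(4)]) auto
  from compact_imp_bounded[OF this] obtain B where B: "\<forall>y\<in>g ` {0..2 * pi}. norm y \<le> B"
    unfolding bounded_iff ..
  have "AE x in M. norm (g x) \<le> B"
    using assms(3) by eventually_elim (use B in \<open>auto simp: circle_def\<close>)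
  moreover have "g \<in> borel_measurable M"
    using assms(2,4) by (simp add: borel_measurable_continuous_onI cong: measurable_cong_sets)
  ultimately show ?thesis by (intro integrable_const_bound)
qed

text \<open>The phase marginals are regarded as measures on the whole line carried by the
  fundamental domain, so that functions which are not periodic can be integrated. The tests are
  independent of time, which suffices to follow moments of the distribution.\<close>

locale identical_oscillators =
  fixes K :: real and \<nu>0 :: "real measure" and \<nu> :: "real \<Rightarrow> real measure"
  assumes K_pos: "0 < K"
    and prob0: "prob_space \<nu>0"
    and sets_nu0: "sets \<nu>0 = sets borel"
    and AE_circle0: "AE x in \<nu>0. x \<in> circle"
    and prob: "0 \<le> t \<Longrightarrow> prob_space (\<nu> t)"
    and sets_nu: "0 \<le> t \<Longrightarrow> sets (\<nu> t) = sets borel"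
    and AE_circle: "0 \<le> t \<Longrightarrow> AE x in \<nu> t. x \<in> circle"
    and continuous_expectation:
      "\<lbrakk>continuous_on UNIV g; \<And>x. g (x + 2 * pi) = g x\<rbrakk>
        \<Longrightarrow> continuous_on {0..} (\<lambda>t. LINT x|\<nu> t. g x)"
    and weak_equation:
      "\<lbrakk>\<And>x. (g has_real_derivative g' x) (at x); continuous_on UNIV g';
        \<And>x. g (x + 2 * pi) = g x; 0 \<le> t\<rbrakk> \<Longrightarrow>
        (LINT x|\<nu> t. g x) - (LINT x|\<nu>0. g x) =
        (LBINT s=0..t. (LINT x|\<nu> s. - K * (LINT y|\<nu> s. sin (x - y)) * g' x))"
begin

section \<open>Evolution of the moments of the phase distribution\<close>

lemma integrable_nu:
  fixes g :: "real \<Rightarrow> real"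
  shows "0 \<le> t \<Longrightarrow> continuous_on UNIV g \<Longrightarrow> integrable (\<nu> t) g"
  using integrable_continuous_circle[OF prob sets_nu AE_circle] by blast

lemma integrable_nu0:
  fixes g :: "real \<Rightarrow> real"
  shows "continuous_on UNIV g \<Longrightarrow> integrable \<nu>0 g"
  using integrable_continuous_circle[OF prob0 sets_nu0 AE_circle0] .

text \<open>The weak equation does not give \<open>\<nu> 0 = \<nu>0\<close> as measures directly, only equal integrals of smooth
  periodic functions.\<close>

lemma expectation_initial:
  assumes "\<And>x. (g has_real_derivative g' x) (at x)" "continuous_on UNIV g'"
    "\<And>x. g (x + 2 * pi) = g x"
  shows "(LINT x|\<nu> 0. g x) = (LINT x|\<nu>0. g x)"
  using weak_equation[OF assms, of 0] by (simp flip: zero_ereal_def)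

text \<open>The addition theorem reduces the mean field to two numbers, the averages of
  \<open>cos\<close> and \<open>sin\<close>, which are the components of the Kuramoto order
  parameter. Double averages thereby become products of single ones.\<close>

lemma expectation_sin_diff:
  "0 \<le> t \<Longrightarrow> (LINT y|\<nu> t. sin (x - y)) =
    sin x * (LINT y|\<nu> t. cos y) - cos x * (LINT y|\<nu> t. sin y)"
  using integrable_nu[OF _ continuous_on_sin[OF continuous_on_id]]
    integrable_nu[OF _ continuous_on_cos[OF continuous_on_id]]
  by (simp add: sin_diff)

text \<open>The integrand on the left depends on time itself. On the right only averages of fixed
  functions occur, whose continuity in time is known when \<open>g'\<close> is periodic.\<close>

lemma expectation_rate:
  assumes "0 \<le> t" "continuous_on UNIV g'"
  shows "(LINT x|\<nu> t. - K * (LINT y|\<nu> t. sin (x - y)) * g' x) =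
    - K * ((LINT y|\<nu> t. cos y) * (LINT x|\<nu> t. sin x * g' x)
      - (LINT y|\<nu> t. sin y) * (LINT x|\<nu> t. cos x * g' x))"
proof -
  have int: "integrable (\<nu> t) (\<lambda>x. sin x * g' x)" "integrable (\<nu> t) (\<lambda>x. cos x * g' x)"
    using assms by (auto intro!: integrable_nu continuous_intros)
  have "(LINT x|\<nu> t. - K * (LINT y|\<nu> t. sin (x - y)) * g' x) =
      (LINT x|\<nu> t. - K * ((LINT y|\<nu> t. cos y) * (sin x * g' x)
        - (LINT y|\<nu> t. sin y) * (cos x * g' x)))"
    by (simp add: expectation_sin_diff assms algebra_simps)
  then show ?thesis
    using int by simp
qed

text \<open>The rate is continuous in time, so the fundamental theorem of calculus applies to the
  integrated weak equation.\<close>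

lemma expectation_has_derivative:
  assumes g: "\<And>x. (g has_real_derivative g' x) (at x)" "continuous_on UNIV g'"
      "\<And>x. g (x + 2 * pi) = g x"
    and "0 < t"
  shows "((\<lambda>t. LINT x|\<nu> t. g x) has_real_derivative
    (LINT x|\<nu> t. - K * (LINT y|\<nu> t. sin (x - y)) * g' x)) (at t)"
proof -
  \<comment> \<open>Continuity of averages in time is available for periodic functions, and
    \<open>g'\<close> enters the rate.\<close>
  have periodic: "g' (x + 2 * pi) = g' x" for x
  proof (rule DERIV_unique)
    show "(g has_real_derivative g' (x + 2 * pi)) (at x)"
      using g(1)[of "x + 2 * pi"] by (simp add: DERIV_shift g(3))
  qed (rule g)
  define k where "k s = (LINT x|\<nu> s. - K * (LINT y|\<nu> s. sin (x - y)) * g' x)" for s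
  \<comment> \<open>This makes \<open>t\<close> an interior point, so that the derivative within the
    interval is a full derivative.\<close>
  define b where "b = t + 1"
  have "continuous_on {0..} (\<lambda>t. - K * ((LINT y|\<nu> t. cos y) * (LINT x|\<nu> t. sin x * g' x)
      - (LINT y|\<nu> t. sin y) * (LINT x|\<nu> t. cos x * g' x)))"
    by (intro continuous_intros continuous_expectation g(2)) (auto simp: periodic)
  then have "continuous_on {0..} k"
    by (rule continuous_on_eq) (simp only: k_def expectation_rate[OF _ g(2)] atLeast_iff)
  then have k_cont: "continuous_on {0..b} k"
    by (rule continuous_on_subset) auto
  have "((\<lambda>u. LBINT s=0..u. k s) has_vector_derivative k t) (at t within {0..b})"
    using interval_integral_FTC2[of 0 0 b k t] k_cont \<open>0 < t\<close>
    by (simp add: b_def zero_ereal_def)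
  moreover have "at t within {0..b} = at t"
    using \<open>0 < t\<close> by (intro at_within_interior) (auto simp: b_def)
  ultimately have *: "((\<lambda>u. (LINT x|\<nu>0. g x) + (LBINT s=0..u. k s)) has_real_derivative k t) (at t)"
    by (auto intro!: derivative_eq_intros simp: has_real_derivative_iff_has_vector_derivative)
  show ?thesis
    unfolding k_def[symmetric]
  proof (rule has_field_derivative_transform_within_open[OF *, where S = "{0<..}"])
    show "(LINT x|\<nu>0. g x) + (LBINT s=0..u. k s) = (LINT x|\<nu> u. g x)" if "u \<in> {0<..}" for u
      using weak_equation[OF g, of u] that by (simp add: k_def)
  qed (use \<open>0 < t\<close> in auto)
qed

text \<open>The arc is described through the cosine, which makes the penalty periodic. The rate of
  its average \<open>m\<close> is bounded by a multiple of the squared average of \<open>p\<close>,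
  and Jensen turns this into a multiple of \<open>m\<close>; since \<open>m 0 = 0\<close>, Gronwall
  leaves \<open>m t = 0\<close>.\<close>

lemma support_invariant:
  assumes \<kappa>: "0 < \<kappa>" "\<kappa> < 1" and init: "AE x in \<nu>0. \<kappa> \<le> cos (x - c)" and "0 \<le> t"
  shows "AE x in \<nu> t. \<kappa> \<le> cos (x - c)"
proof -
  define p where "p x = max 0 (\<kappa> - cos (x - c))" for x
  define w where "w x = max 0 (\<kappa>\<^sup>2 - (p x)\<^sup>2)" for x
  \<comment> \<open>The penalty is comparable to \<open>(p x)\<^sup>2\<close>, but constant where \<open>cos (x - c) \<le> 0\<close>: the velocity may
    have the wrong sign near the antipode of the arc.\<close>
  define g where "g x = \<kappa> ^ 4 - pos_sq (\<kappa>\<^sup>2 - pos_sq (\<kappa> - cos (x - c)))" for x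
  define g' where "g' x = 4 * (sin (x - c) * (p x * w x))" for x
  define L where "L = 1 + \<kappa> / sqrt (1 - \<kappa>\<^sup>2)"
  \<comment> \<open>Chosen for \<open>q * (p x)\<^sup>2 \<le> g x\<close>: as
    \<open>p x \<le> 2\<close>, the left side is at most \<open>\<kappa> ^ 4\<close>, the value of
    \<open>g x\<close> once \<open>p x\<close> exceeds \<open>\<kappa>\<close>. For smaller
    \<open>p x\<close> it follows from
    \<open>g x = (p x)\<^sup>2 * (2 * \<kappa>\<^sup>2 - (p x)\<^sup>2)\<close>.\<close>
  define q where "q = \<kappa> ^ 4 / 4"
  have q: "0 < q" using \<kappa> by (simp add: q_def)
  have p_sq: "pos_sq (\<kappa> - cos (x - c)) = (p x)\<^sup>2" for x
    by (simp add: pos_sq_def p_def)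
  have p0: "p x \<ge> 0" for x by (simp add: p_def)
  have deriv: "(g has_real_derivative g' x) (at x)" for x
    unfolding g_def g'_def
    by (auto intro!: derivative_eq_intros simp: w_def p_sq[symmetric] p_def[symmetric])
  have cont_p: "continuous_on A p" for A
    unfolding p_def by (intro continuous_intros)
  have cont_g': "continuous_on UNIV g'"
    unfolding g'_def w_def by (intro continuous_intros cont_p)
  have cont_g: "continuous_on UNIV g"
    using deriv by (rule DERIV_imp_continuous_on)
  have periodic: "g (x + 2 * pi) = g x" for x
    using cos_periodic[of "x - c"] by (simp add: g_def algebra_simps)
  have lower: "q * (p x)\<^sup>2 \<le> g x" for x
  proof (cases "(p x)\<^sup>2 \<le> \<kappa>\<^sup>2")
    case True
    have "g x = \<kappa> ^ 4 - (\<kappa>\<^sup>2 - (p x)\<^sup>2)\<^sup>2"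
      using True by (simp add: g_def p_sq) (simp add: pos_sq_def)
    then have "g x = (p x)\<^sup>2 * (2 * \<kappa>\<^sup>2 - (p x)\<^sup>2)"
      by (simp add: algebra_simps power2_eq_square power4_eq_xxxx)
    moreover have "q \<le> 2 * \<kappa>\<^sup>2 - (p x)\<^sup>2"
    proof -
      have "\<kappa> ^ 4 \<le> \<kappa>\<^sup>2" using \<kappa> by (intro power_decreasing) auto
      then show ?thesis using True \<open>0 < q\<close> unfolding q_def by linarith
    qed
    ultimately show ?thesis
      using mult_right_mono[of q "2 * \<kappa>\<^sup>2 - (p x)\<^sup>2" "(p x)\<^sup>2"] by (simp add: mult.commute)
  next
    case False
    have "p x \<le> 2" using \<kappa> cos_ge_minus_one[of "x - c"] unfolding p_def by linarith
    then have "(p x)\<^sup>2 \<le> 2\<^sup>2" using p0 by (intro power_mono)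
    then have "q * (p x)\<^sup>2 \<le> q * 4" using q by simp
    also have "\<dots> = g x" using False by (simp add: q_def g_def p_sq)
    finally show ?thesis .
  qed
  have g0: "g x \<ge> 0" for x
    using order.trans[OF _ lower[of x]] q by simp
  have g_zero_iff: "g x = 0 \<longleftrightarrow> \<kappa> \<le> cos (x - c)" for x
  proof
    assume "g x = 0"
    then have "(p x)\<^sup>2 \<le> 0"
      using lower[of x] q by (simp add: mult_le_0_iff)
    then show "\<kappa> \<le> cos (x - c)" by (simp add: p_def max_def split: if_splits)
  next
    assume "\<kappa> \<le> cos (x - c)"
    then show "g x = 0" by (simp add: g_def pos_sq_def)
  qed
  define m where "m t = (LINT x|\<nu> t. g x)" for t
  have rate_le: "(LINT x|\<nu> s. - K * (LINT y|\<nu> s. sin (x - y)) * g' x) \<le> 4 * K * L / q * m s"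
    if "0 \<le> s" for s
  proof -
    interpret prob_space "\<nu> s" using prob that .
    define P where "P = expectation p"
    have int_p: "integrable (\<nu> s) p" using integrable_nu[OF that cont_p] .
    \<comment> \<open>For fixed \<open>x\<close>, \<open>kernel_bound\<close> is averaged over
      \<open>y\<close>; the factor 4 comes from \<open>g'\<close>.\<close>
    have le: "- K * (LINT y|\<nu> s. sin (x - y)) * g' x \<le> 4 * K * L * P * p x" for x
    proof -
      have "(LINT y|\<nu> s. - sin (x - y) * (sin (x - c) * (p x * w x))) \<le>
          (LINT y|\<nu> s. L * (p x * p y))"
      proof (rule integral_mono)
        show "integrable (\<nu> s) (\<lambda>y. - sin (x - y) * (sin (x - c) * (p x * w x)))"
          by (intro integrable_nu that continuous_intros)
        show "integrable (\<nu> s) (\<lambda>y. L * (p x * p y))"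
          by (intro integrable_nu that continuous_intros cont_p)
        show "- sin (x - y) * (sin (x - c) * (p x * w x)) \<le> L * (p x * p y)" for y
          using kernel_bound[OF \<kappa>, of "x - c" "y - c"] by (simp add: p_def w_def L_def)
      qed
      then have "(4 * K) * (- (LINT y|\<nu> s. sin (x - y)) * (sin (x - c) * (p x * w x)))
          \<le> (4 * K) * (L * (p x * P))"
        using K_pos int_p by (intro mult_left_mono) (auto simp: P_def)
      then show ?thesis by (simp add: g'_def mult_ac)
    qed
    have "(LINT x|\<nu> s. - K * (LINT y|\<nu> s. sin (x - y)) * g' x) \<le>
        (LINT x|\<nu> s. 4 * K * L * P * p x)"
    proof (rule integral_mono)
      have "continuous_on UNIV (\<lambda>x. - K * (sin x * (LINT y|\<nu> s. cos y) - cos x * (LINT y|\<nu> s. sin y)) * g' x)"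
        by (intro continuous_intros cont_g')
      then show "integrable (\<nu> s) (\<lambda>x. - K * (LINT y|\<nu> s. sin (x - y)) * g' x)"
        unfolding expectation_sin_diff[OF that] by (rule integrable_nu[OF that])
    qed (use int_p le in auto)
    also have "\<dots> = 4 * K * L * P\<^sup>2"
      using int_p by (simp add: P_def power2_eq_square)
    also have "\<dots> \<le> 4 * K * L * (m s / q)"
    proof (rule mult_left_mono)
      have "P\<^sup>2 \<le> expectation (\<lambda>x. (p x)\<^sup>2)"
        unfolding P_def by (intro expectation_square_ge integrable_nu that continuous_intros cont_p)
      also have "\<dots> \<le> expectation (\<lambda>x. g x / q)"
        using lower q
        by (intro integral_mono integrable_nu that continuous_intros cont_p cont_g)
          (auto simp: field_simps)
      finally show "P\<^sup>2 \<le> m s / q" by (simp add: m_def)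
      have "\<kappa>\<^sup>2 < 1" using \<kappa> by (simp add: power_less_one_iff)
      then show "0 \<le> 4 * K * L" using \<kappa> K_pos by (simp add: L_def)
    qed
    finally show ?thesis by simp
  qed
  have "m t \<le> m 0 * exp (4 * K * L / q * t)"
  proof (rule exp_bound_of_derivative_le)
    show "continuous_on {0..} m"
      unfolding m_def by (intro continuous_expectation cont_g periodic)
    show "(m has_real_derivative (LINT x|\<nu> s. - K * (LINT y|\<nu> s. sin (x - y)) * g' x)) (at s)"
      if "0 < s" for s
      unfolding m_def using expectation_has_derivative[OF deriv cont_g' periodic that] .
    show "(LINT x|\<nu> s. - K * (LINT y|\<nu> s. sin (x - y)) * g' x) \<le> 4 * K * L / q * m s"
      if "0 < s" for s
      using rate_le that by simp
  qed fact
  moreover have "m 0 = 0"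
  proof -
    have "m 0 = (LINT x|\<nu>0. g x)"
      unfolding m_def using deriv cont_g' periodic by (rule expectation_initial)
    also have "\<dots> = 0"
      using init by (subst integral_nonneg_eq_0_iff_AE)
        (auto simp: g0 g_zero_iff integrable_nu0 cont_g)
    finally show ?thesis .
  qed
  moreover have "0 \<le> m t"
    by (simp add: m_def g0)
  ultimately have "m t = 0" by simp
  then have "AE x in \<nu> t. g x = 0"
    unfolding m_def using \<open>0 \<le> t\<close>
    by (subst (asm) integral_nonneg_eq_0_iff_AE) (auto simp: g0 integrable_nu cont_g)
  then show ?thesis by (simp add: g_zero_iff)
qed

text \<open>The centre \<open>c\<close> of the arc and the mean \<open>pi\<close> of the phases may
  differ; \<open>\<bar>c - pi\<bar> \<le> \<delta>\<close> keeps the arc inside the fundamental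
  domain, where phases can be averaged without ambiguity.\<close>

lemma concentration:
  assumes c: "\<bar>c - pi\<bar> \<le> \<delta>" and \<delta>: "0 < \<delta>" "\<delta> < pi / 2"
    and init: "AE x in \<nu>0. \<bar>x - c\<bar> \<le> \<delta>" and mean: "(LINT x|\<nu>0. x) = pi"
  shows "((\<lambda>t. LINT x|\<nu> t. \<bar>x - pi\<bar>) \<longlongrightarrow> 0) at_top"
proof -
  have "cos 0 > cos \<delta>" using \<delta> by (subst cos_mono_less_eq) auto
  then have \<kappa>: "0 < cos \<delta>" "cos \<delta> < 1" using \<delta> by (auto intro!: cos_gt_zero)
  have cos_ge: "cos \<delta> \<le> cos (x - c)" if "\<bar>x - c\<bar> \<le> \<delta>" for x
  proof -
    have "cos \<delta> \<le> cos \<bar>x - c\<bar>" using that \<delta> by (subst cos_mono_le_eq) auto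
    then show ?thesis by simp
  qed
  have init': "AE x in \<nu>0. cos \<delta> \<le> cos (x - c)"
    using init cos_ge by (auto elim!: eventually_mono)
  \<comment> \<open>The cosine determines \<open>x - c\<close> only up to sign and multiples of
    \<open>2 * pi\<close>; the other copies of the arc begin at distance
    \<open>2 * pi - \<delta>\<close>, which is more than \<open>3 * pi / 2\<close>.\<close>
  have close: "\<bar>x - c\<bar> \<le> \<delta>" if "x \<in> circle" "cos \<delta> \<le> cos (x - c)" for x
  proof (rule ccontr)
    assume "\<not> ?thesis"
    moreover have "\<bar>x - c\<bar> < 3 * pi / 2"
      using that(1) c \<delta> unfolding circle_def abs_less_iff abs_le_iff by auto
    moreover have "\<delta> < \<bar>x - c\<bar> \<Longrightarrow> \<bar>x - c\<bar> \<le> pi \<Longrightarrow> cos \<bar>x - c\<bar> < cos \<delta>"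
      using \<delta> by (subst cos_mono_less_eq) auto
    moreover have "pi < \<bar>x - c\<bar> \<Longrightarrow> cos (2 * pi - \<bar>x - c\<bar>) < cos \<delta>" 
      using \<open>\<bar>x - c\<bar> < 3 * pi / 2\<close> \<delta> by (subst cos_mono_less_eq) auto
    ultimately show False using that(2) by (cases "\<bar>x - c\<bar> \<le> pi") (auto simp: not_le)
  qed
  have supp: "AE x in \<nu> t. \<bar>x - c\<bar> \<le> \<delta>" if "0 \<le> t" for t
    using support_invariant[OF \<kappa> init' that] AE_circle[OF that] by eventually_elim (rule close)
  have "2 * \<delta> < pi" using \<delta> by simp
  \<comment> \<open>Points of the arc are within \<open>2 * \<delta>\<close> of \<open>pi\<close>;
    the strict gaps let \<open>F\<close> be the shifted phase on a whole neighbourhood of the arc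
    and still be modified before the jump.\<close>
  then obtain E where E: "2 * \<delta> < E" "E < pi" using dense by blast
  have "0 < E" using E \<delta> by simp
  obtain F F' where
    F: "\<And>x. (F has_real_derivative F' x) (at x)" "continuous_on UNIV F'" "\<And>x. F (x + 2 * pi) = F x"
    and F_eq: "\<And>x. \<bar>x - pi\<bar> < E \<Longrightarrow> F x = x - pi" and F'_eq: "\<And>x. \<bar>x - pi\<bar> < E \<Longrightarrow> F' x = 1"
    using angle_function_exists[OF \<open>0 < E\<close> E(2)] by metis
  have F_supp: "AE x in \<nu> t. \<bar>x - c\<bar> \<le> \<delta> \<and> F x = x - pi \<and> F' x = 1" if "0 \<le> t" for t
    using supp[OF that] by eventually_elim (use c E in \<open>auto intro!: F_eq F'_eq\<close>)
  have cont_F: "continuous_on A F" for A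
    using F(1) by (rule DERIV_imp_continuous_on)
  have F_meas: "F \<in> borel_measurable (\<nu> t)" "F' \<in> borel_measurable (\<nu> t)" if "0 \<le> t" for t
    using integrable_nu[OF that] cont_F F(2) by auto
  define J where "J t x = (LINT y|\<nu> t. sin (x - y))" for t x
  have J: "J t x = sin x * (LINT y|\<nu> t. cos y) - cos x * (LINT y|\<nu> t. sin y)" if "0 \<le> t" for t x
    unfolding J_def using expectation_sin_diff[OF that] .
  have J_cont: "continuous_on UNIV (J t)" if "0 \<le> t" for t
    by (subst continuous_on_cong[OF refl J[OF that]]) (intro continuous_intros)
  have mean_zero: "(LINT x|\<nu> t. F x) = 0" if "0 \<le> t" for t
  proof -
    have "(LINT x|\<nu> t. F x) = (LINT x|\<nu> 0. F x)"
    proof (cases "t = 0")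
      case False
      show ?thesis
      proof (rule DERIV_isconst2[of 0 t "\<lambda>t. LINT x|\<nu> t. F x" t])
        show "continuous_on {0..t} (\<lambda>t. LINT x|\<nu> t. F x)"
          by (rule continuous_on_subset[OF continuous_expectation]) (auto simp: F cont_F)
        fix s assume s: "0 < s" "s < t"
        have "(LINT x|\<nu> s. - K * J s x * F' x) = (LINT x|\<nu> s. - K * J s x * 1)"
        proof (rule integral_cong_AE)
          show "AE x in \<nu> s. - K * J s x * F' x = - K * J s x * 1"
            using F_supp[OF less_imp_le[OF s(1)]] by eventually_elim simp
        qed (use s F_meas J_cont in \<open>auto intro!: borel_measurable_integrable integrable_nu continuous_intros F(2)\<close>)
        also have "\<dots> = - K * (LINT x|\<nu> s. J s x)" by simp
        \<comment> \<open>Antisymmetry of the sine appears as the cancellation of two equal products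
          of moments.\<close>
        also have "(LINT x|\<nu> s. J s x) = 0"
          using s integrable_nu[OF _ continuous_on_sin[OF continuous_on_id], of s]
            integrable_nu[OF _ continuous_on_cos[OF continuous_on_id], of s]
          by (simp add: J)
        finally show "((\<lambda>t. LINT x|\<nu> t. F x) has_real_derivative 0) (at s)"
          using expectation_has_derivative[OF F s(1)] by (simp add: J_def)
      qed (use that False in auto)
    qed auto
    also have "\<dots> = (LINT x|\<nu>0. F x)"
      using F by (rule expectation_initial)
    also have "\<dots> = (LINT x|\<nu>0. x - pi)"
    proof (rule integral_cong_AE)
      show "AE x in \<nu>0. F x = x - pi"
        using init by eventually_elim (use c E in \<open>auto intro!: F_eq\<close>)
    qed (auto intro!: borel_measurable_integrable integrable_nu0 continuous_intros cont_F)
    also have "\<dots> = 0"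
      using mean prob_space.prob_space[OF prob0] by (simp add: integrable_nu0)
    finally show ?thesis .
  qed
  obtain r where r: "0 < r" "\<And>u. \<bar>u\<bar> \<le> 2 * \<delta> \<Longrightarrow> r * u\<^sup>2 \<le> u * sin u"
    using sin_mult_ge[of "2 * \<delta>"] \<delta> by auto
  define V where "V t = (LINT x|\<nu> t. (F x)\<^sup>2)" for t
  have cont_F2: "continuous_on UNIV (\<lambda>x. (F x)\<^sup>2)" by (intro continuous_intros cont_F)
  have rate: "(LINT x|\<nu> t. - K * J t x * (2 * F x * F' x)) \<le> - (2 * K * r) * V t" if t: "0 < t" for t
  proof -
    note t0 = less_imp_le[OF t]
    note int = integrable_nu[OF t0]
    interpret prob_space "\<nu> t" using prob t0 .
    define C S A B where "C = expectation cos" and "S = expectation sin"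
      and "A = expectation (\<lambda>x. F x * cos x)" and "B = expectation (\<lambda>x. F x * sin x)"
    \<comment> \<open>Symmetrization: the average of \<open>I\<close> is twice the average of
      \<open>F x * sin (x - y)\<close> over independent \<open>x\<close> and \<open>y\<close>, the
      quantity in the rate of the variance. It expands into the moments \<open>A\<close>,
      \<open>B\<close>, \<open>C\<close>, \<open>S\<close>.\<close>
    define I where "I x = (LINT y|\<nu> t. (F x - F y) * sin (x - y))" for x
    have ints: "integrable (\<nu> t) sin" "integrable (\<nu> t) cos" "integrable (\<nu> t) F"
      "integrable (\<nu> t) (\<lambda>x. (F x)\<^sup>2)"
      "integrable (\<nu> t) (\<lambda>x. F x * cos x)" "integrable (\<nu> t) (\<lambda>x. F x * sin x)"
      by (intro int continuous_intros cont_F)+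
    have I: "I x = (F x * sin x * C - F x * cos x * S) - (sin x * A - cos x * B)" for x
    proof -
      have "I x = (LINT y|\<nu> t. (F x * sin x * cos y - F x * cos x * sin y)
          - (sin x * (F y * cos y) - cos x * (F y * sin y)))"
        unfolding I_def by (simp add: sin_diff algebra_simps)
      then show ?thesis using ints by (simp add: A_def B_def C_def S_def)
    qed
    have "r * ((F x)\<^sup>2 + V t) \<le> I x" if x: "\<bar>x - c\<bar> \<le> \<delta>" "F x = x - pi" for x
    proof -
      have "(LINT y|\<nu> t. r * (F x - F y)\<^sup>2) \<le> I x"
        unfolding I_def
      proof (rule integral_mono_AE)
        show "AE y in \<nu> t. r * (F x - F y)\<^sup>2 \<le> (F x - F y) * sin (x - y)"
          using F_supp[OF t0]
        proof eventually_elim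
          case (elim y)
          then have "\<bar>x - y\<bar> \<le> 2 * \<delta>"
            using x(1) unfolding abs_le_iff by auto
          then show ?case using r(2)[of "x - y"] x elim by simp
        qed
      qed (intro int continuous_intros cont_F)+
      also have "(LINT y|\<nu> t. r * (F x - F y)\<^sup>2) =
          (LINT y|\<nu> t. r * (((F x)\<^sup>2 - 2 * F x * F y) + (F y)\<^sup>2))"
        by (simp add: power2_diff algebra_simps)
      \<comment> \<open>The mixed term vanishes because the mean of \<open>F\<close> is zero.
        Averaging over \<open>x\<close> then yields the variance twice, which balances the factor
        from symmetrization.\<close>
      also have "\<dots> = r * ((F x)\<^sup>2 + V t)"
        using ints mean_zero[OF t0] prob_space by (simp add: V_def)
      finally show ?thesis .
    qed
    then have ae: "AE x in \<nu> t. r * ((F x)\<^sup>2 + V t) \<le> I x"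
      using F_supp[OF t0] by auto
    have "(LINT x|\<nu> t. r * ((F x)\<^sup>2 + V t)) \<le> (LINT x|\<nu> t. I x)"
    proof (rule integral_mono_AE[OF _ _ ae])
      show "integrable (\<nu> t) I"
        unfolding I by (intro int continuous_intros cont_F)
    qed (intro int continuous_intros cont_F)
    also have "(LINT x|\<nu> t. r * ((F x)\<^sup>2 + V t)) = 2 * r * V t"
      using ints prob_space by (simp add: V_def)
    also have "(LINT x|\<nu> t. I x) = 2 * (B * C - A * S)"
      unfolding I using ints by (simp add: A_def B_def C_def S_def)
    finally have le: "r * V t \<le> B * C - A * S" by simp
    have "(LINT x|\<nu> t. - K * J t x * (2 * F x * F' x)) =
        (LINT x|\<nu> t. - (2 * K) * ((F x * sin x) * C - (F x * cos x) * S))"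
    proof (rule integral_cong_AE)
      show "AE x in \<nu> t. - K * J t x * (2 * F x * F' x) =
          - (2 * K) * ((F x * sin x) * C - (F x * cos x) * S)"
        using F_supp[OF t0] by eventually_elim (simp add: J[OF t0] C_def S_def algebra_simps)
    qed (auto intro!: borel_measurable_integrable int continuous_intros cont_F F(2) J_cont t0)
    also have "\<dots> = - (2 * K) * (B * C - A * S)"
      using ints by (simp add: A_def B_def)
    also have "\<dots> \<le> - (2 * K) * (r * V t)"
      using le K_pos by (intro mult_left_mono_neg) auto
    finally show ?thesis by simp
  qed
  have decay: "V t \<le> V 0 * exp (- (2 * K * r) * t)" if "0 \<le> t" for t
  proof (rule exp_bound_of_derivative_le[OF _ _ rate that])
    show "continuous_on {0..} V"
      unfolding V_def by (intro continuous_expectation cont_F2) (simp add: F)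
    show "(V has_real_derivative (LINT x|\<nu> s. - K * J s x * (2 * F x * F' x))) (at s)" if "0 < s" for s
      unfolding V_def J_def
    proof (rule expectation_has_derivative[OF _ _ _ that])
      show "((\<lambda>x. (F x)\<^sup>2) has_real_derivative 2 * F x * F' x) (at x)" for x
        by (auto intro!: derivative_eq_intros F)
    qed (auto intro!: continuous_intros cont_F F(2) simp: F(3))
  qed
  have "eventually (\<lambda>t. norm (LINT x|\<nu> t. \<bar>x - pi\<bar>) \<le> sqrt (V 0 * exp (- (2 * K * r) * t))) at_top"
    using eventually_ge_at_top[of 0]
  proof eventually_elim
    case (elim t)
    interpret prob_space "\<nu> t" using prob elim .
    have "expectation (\<lambda>x. \<bar>x - pi\<bar>) = expectation (\<lambda>x. \<bar>F x\<bar>)"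
    proof (rule integral_cong_AE)
      show "AE x in \<nu> t. \<bar>x - pi\<bar> = \<bar>F x\<bar>"
        using F_supp[OF elim] by eventually_elim simp
    qed (auto intro!: borel_measurable_integrable integrable_nu elim continuous_intros cont_F)
    moreover have "(expectation (\<lambda>x. \<bar>F x\<bar>))\<^sup>2 \<le> expectation (\<lambda>x. \<bar>F x\<bar>\<^sup>2)"
      by (intro expectation_square_ge integrable_nu elim continuous_intros cont_F)
    ultimately show ?case
      using decay[OF elim] by (intro real_le_rsqrt) (simp add: V_def)
  qed
  moreover have "((\<lambda>t. sqrt (V 0 * exp (- (2 * K * r) * t))) \<longlongrightarrow> sqrt (V 0 * 0)) at_top"
  proof (intro tendsto_intros filterlim_compose[OF exp_at_bot])
    show "filterlim (\<lambda>t. - (2 * K * r) * t) at_bot at_top"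
      using K_pos r(1) by (intro filterlim_tendsto_neg_mult_at_bot[OF tendsto_const]) (auto simp: filterlim_ident)
  qed
  then have "((\<lambda>t. sqrt (V 0 * exp (- (2 * K * r) * t))) \<longlongrightarrow> 0) at_top" by simp
  ultimately show ?thesis by (rule Lim_null_comparison)
qed

end

section \<open>Measures on the phase space\<close>

lemma sets_phase_space: "phase_space \<in> sets borel"
proof -
  have "phase_space = circle \<times> UNIV" by (simp add: phase_space_def)
  also have "\<dots> \<in> sets (borel \<Otimes>\<^sub>M borel)" unfolding circle_def by (intro pair_measureI) auto
  finally show ?thesis unfolding borel_prod by simp
qed

context
  fixes M :: "(real \<times> real) measure"
  assumes M: "M \<in> radon_measures"
begin

lemma radon_sets: "sets M = sets (restrict_space borel phase_space)"
  using M by (simp add: radon_measures_def)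

lemma radon_space: "space M = phase_space"
  using sets_eq_imp_space_eq[OF radon_sets] by (simp add: space_restrict_space)

lemma radon_measurable: "f \<in> borel \<rightarrow>\<^sub>M N \<Longrightarrow> f \<in> M \<rightarrow>\<^sub>M N"
  unfolding measurable_cong_sets[OF radon_sets refl] by (rule measurable_restrict_space1)

text \<open>This serves while the total mass of the solution is not yet known to be finite: the set
  \<open>S\<close> with its bounded range of frequencies has finite measure, and \<open>f\<close> is
  bounded there.\<close>

lemma radon_integrable:
  fixes f :: "real \<times> real \<Rightarrow> real"
  assumes f: "continuous_on UNIV f" and supp: "\<And>z. r < \<bar>snd z\<bar> \<Longrightarrow> f z = 0"
  shows "integrable M f"
proof -
  define S where "S = circle \<times> {-r..r}"
  have "S \<in> sets (borel \<Otimes>\<^sub>M borel)" unfolding S_def circle_def by (intro pair_measureI) auto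
  then have "S \<in> sets borel" unfolding borel_prod by simp
  moreover have "S \<subseteq> phase_space" by (auto simp: S_def phase_space_def)
  ultimately have S: "S \<in> sets M"
    using sets_phase_space unfolding radon_sets by (auto simp: sets_restrict_space)
  have fin: "emeasure M S < \<infinity>"
    using M by (simp add: S_def radon_measures_def)
  have "compact (f ` ({0..2 * pi} \<times> {-r..r}))"
    by (intro compact_continuous_image compact_Times compact_Icc continuous_on_subset[OF f]) auto
  from compact_imp_bounded[OF this]
  obtain B where B: "\<forall>y\<in>f ` ({0..2 * pi} \<times> {-r..r}). norm y \<le> B"
    unfolding bounded_iff ..
  have "integrable M (\<lambda>z. B * indicator S z)"
    using S fin by (intro integrable_mult_right) (simp add: integrable_real_indicator)
  then show ?thesis
  proof (rule Bochner_Integration.integrable_bound)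
    show "f \<in> borel_measurable M"
      using f by (intro radon_measurable borel_measurable_continuous_onI)
    have "norm (f z) \<le> norm (B * indicator S z)" if "z \<in> phase_space" for z
    proof (cases "z \<in> S")
      case True
      then have "z \<in> {0..2 * pi} \<times> {-r..r}" by (auto simp: S_def circle_def)
      then have "norm (f z) \<le> B" using B by blast
      then show ?thesis using True by simp
    next
      case False
      then have "r < \<bar>snd z\<bar>" using that by (cases z) (auto simp: S_def phase_space_def)
      then show ?thesis using supp by simp
    qed
    then show "AE z in M. norm (f z) \<le> norm (B * indicator S z)"
      by (intro AE_I2) (simp add: radon_space)
  qed
qed

text \<open>The topology has a countable basis: every point outside the support has a basic open
  neighbourhood of measure zero, and countably many of these cover the complement.\<close>

lemma AE_spt: "AE z in M. z \<in> spt M"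
proof -
  obtain \<B> :: "(complex \<times> real) set set" where \<B>: "countable \<B>" "topological_basis \<B>"
    using ex_countable_basis by blast
  define P where "P U = {w \<in> phase_space. embed w \<in> U}" for U
  have "continuous_on UNIV embed"
    unfolding embed_def by (intro continuous_intros)
  then have P_sets: "P U \<in> sets M" if "open U" for U
  proof -
    have "embed -` U \<in> sets borel"
      using \<open>continuous_on UNIV embed\<close> that by (intro borel_open open_vimage)
    moreover have "P U = phase_space \<inter> embed -` U" by (auto simp: P_def)
    ultimately show ?thesis unfolding radon_sets sets_restrict_space by auto
  qed
  define N where "N = (\<Union>B\<in>{B \<in> \<B>. emeasure M (P B) = 0}. P B)"
  have "N \<in> null_sets M"
    unfolding N_def using \<B> by (intro null_sets_UN')
      (auto intro!: null_setsI P_sets simp: topological_basis_open)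
  moreover have "{z \<in> space M. z \<notin> spt M} \<subseteq> N"
  proof
    fix z assume "z \<in> {z \<in> space M. z \<notin> spt M}"
    then obtain U where U: "z \<in> phase_space" "open U" "embed z \<in> U" "emeasure M (P U) = 0"
      unfolding spt_def radon_space P_def by (auto simp: not_less)
    obtain B where B: "B \<in> \<B>" "embed z \<in> B" "B \<subseteq> U"
      using topological_basisE[OF \<B>(2) U(2,3)] by blast
    have "emeasure M (P B) \<le> emeasure M (P U)"
      using B U P_sets by (intro emeasure_mono) (auto simp: P_def)
    then show "z \<in> N" using U B by (auto simp: N_def P_def)
  qed
  ultimately show ?thesis by (rule AE_I')
qed

end

text \<open>\<open>N\<close> is characterized by its integrals as the Dirac measure at
  \<open>Z\<close>. The mean of a test function \<open>h\<close> differs from \<open>h Z\<close> by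
  at most the mean distance to \<open>Z\<close>, as its Lipschitz constant is at most one.\<close>

lemma bounded_lipschitz_dist_tendsto_0:
  assumes Z: "Z \<in> phase_space" and R: "(R \<longlongrightarrow> 0) F"
    and le: "eventually (\<lambda>t. \<mu> t \<in> radon_measures \<and> prob_space (\<mu> t) \<and>
      integrable (\<mu> t) (\<lambda>z. dist z Z) \<and> (LINT z|\<mu> t. dist z Z) \<le> R t) F"
    and N: "\<And>h :: real \<times> real \<Rightarrow> real. h \<in> borel_measurable (restrict_space borel phase_space) \<Longrightarrow> (LINT z|N. h z) = h Z"
  shows "((\<lambda>t. bounded_lipschitz_dist (\<mu> t) N) \<longlongrightarrow> 0) F"
proof -
  define H :: "(real \<times> real \<Rightarrow> real) set"
    where "H = {h. (\<forall>z \<in> phase_space. \<bar>h z\<bar> \<le> 1) \<and> 1-lipschitz_on phase_space h}"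
  have zero: "(\<lambda>_. 0) \<in> H" by (auto simp: H_def lipschitz_on_def)
  have "norm (bounded_lipschitz_dist (\<mu> t) N) \<le> R t"
    if \<mu>: "\<mu> t \<in> radon_measures" and prob: "prob_space (\<mu> t)"
      and int: "integrable (\<mu> t) (\<lambda>z. dist z Z)" "(LINT z|\<mu> t. dist z Z) \<le> R t" for t
  proof -
    interpret prob_space "\<mu> t" by fact
    have bound: "\<bar>(LINT z|\<mu> t. h z) - (LINT z|N. h z)\<bar> \<le> R t" if h: "h \<in> H" for h
    proof -
      have lip: "1-lipschitz_on phase_space h" and one: "\<And>z. z \<in> phase_space \<Longrightarrow> \<bar>h z\<bar> \<le> 1"
        using h by (auto simp: H_def)
      have meas: "h \<in> borel_measurable (restrict_space borel phase_space)"
        by (rule borel_measurable_continuous_on_restrict[OF lipschitz_on_continuous_on[OF lip]])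
      have int_h: "integrable (\<mu> t) h"
      proof (rule integrable_const_bound[where B = 1])
        show "h \<in> borel_measurable (\<mu> t)"
          using meas by (simp cong: measurable_cong_sets add: radon_sets[OF \<mu>])
        show "AE z in \<mu> t. norm (h z) \<le> 1"
          using one by (intro AE_I2) (simp add: radon_space[OF \<mu>])
      qed
      have "(LINT z|\<mu> t. h z) - h Z = (LINT z|\<mu> t. h z - h Z)"
        using int_h prob_space by simp
      also have "\<bar>\<dots>\<bar> \<le> (LINT z|\<mu> t. \<bar>h z - h Z\<bar>)"
        by (rule integral_abs_bound)
      also have "\<dots> \<le> (LINT z|\<mu> t. dist z Z)"
      proof (rule integral_mono[OF _ int(1)])
        fix z assume "z \<in> space (\<mu> t)"
        then show "\<bar>h z - h Z\<bar> \<le> dist z Z"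
          using lipschitz_onD[OF lip _ Z, of z] by (simp add: radon_space[OF \<mu>] dist_real_def)
      qed (use int_h in simp)
      finally show ?thesis using int(2) N[OF meas] by simp
    qed
    have "bounded_lipschitz_dist (\<mu> t) N \<le> R t"
      unfolding bounded_lipschitz_dist_def H_def[symmetric]
      using zero bound by (intro cSUP_least) auto
    \<comment> \<open>The zero test function shows that the supremum is nonnegative;
      \<open>bound\<close> supplies the boundedness that a real supremum requires.\<close>
    moreover have "\<bar>(LINT z|\<mu> t. (0::real)) - (LINT z|N. 0)\<bar> \<le> bounded_lipschitz_dist (\<mu> t) N"
      unfolding bounded_lipschitz_dist_def H_def[symmetric]
      using zero bound by (intro cSUP_upper2[where x = "\<lambda>_. 0"] bdd_aboveI2) auto
    ultimately show ?thesis by simp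
  qed
  then have "eventually (\<lambda>t. norm (bounded_lipschitz_dist (\<mu> t) N) \<le> R t) F"
    using le by (auto elim!: eventually_mono)
  then show ?thesis by (rule Lim_null_comparison) (rule R)
qed

lemma integral_mu_infinity:
  fixes h :: "real \<times> real \<Rightarrow> real"
  assumes "theta_c M \<in> circle" "h \<in> borel_measurable (restrict_space borel phase_space)"
  shows "(LINT z|mu_infinity M. h z) = h (theta_c M, Omega_c M)"
proof -
  let ?C = "restrict_space borel circle" and ?L = "borel :: real measure" and ?a = "theta_c M" and ?b = "Omega_c M"
  have a: "?a \<in> space ?C" using assms(1) by (simp add: space_restrict_space)
  interpret A: prob_space "return ?C ?a" by (rule prob_space_return[OF a])
  interpret B: prob_space "return borel ?b" by (rule prob_space_return) simp
  interpret P: pair_prob_space "return ?C ?a" "return borel ?b" ..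
  \<comment> \<open>\<open>h\<close> is Borel on the phase space as a subspace of the plane, while
    the Dirac measures live on a product \<sigma>-algebra; the identity is measurable from the
    latter to the former.\<close>
  have "(\<lambda>z. z) \<in> ?C \<Otimes>\<^sub>M ?L \<rightarrow>\<^sub>M restrict_space borel phase_space"
  proof (rule measurable_restrict_space2)
    show "(\<lambda>z. z) \<in> space (?C \<Otimes>\<^sub>M ?L) \<rightarrow> phase_space"
      by (auto simp: space_pair_measure space_restrict_space phase_space_def)
    have "(\<lambda>x. x) \<in> borel_measurable ?C" by (rule measurable_restrict_space1) simp
    then have "(\<lambda>z. (fst z, snd z)) \<in> ?C \<Otimes>\<^sub>M ?L \<rightarrow>\<^sub>M borel \<Otimes>\<^sub>M borel"
      by (intro measurable_Pair measurable_compose[OF measurable_fst] measurable_snd)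
    then show "(\<lambda>z. z) \<in> ?C \<Otimes>\<^sub>M ?L \<rightarrow>\<^sub>M borel" unfolding borel_prod by simp
  qed
  from measurable_compose[OF this assms(2)]
  have h: "h \<in> borel_measurable (?C \<Otimes>\<^sub>M ?L)" .
  have sets: "sets (mu_infinity M) = sets (?C \<Otimes>\<^sub>M ?L)"
    unfolding mu_infinity_def by (intro sets_pair_measure_cong) auto
  have "?a \<in> circle" "{?a} \<in> sets ?C"
    using assms(1) by (auto simp: sets_restrict_space intro!: image_eqI[where x = "{?a}"])
  then have "emeasure (mu_infinity M) ({?a} \<times> {?b}) = 1"
    unfolding mu_infinity_def by (subst B.emeasure_pair_measure_Times) auto
  then have "P.prob ({?a} \<times> {?b}) = 1"
    by (simp add: mu_infinity_def P.emeasure_eq_measure)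
  then have "AE z in mu_infinity M. z \<in> {?a} \<times> {?b}"
    unfolding mu_infinity_def by (rule P.AE_prob_1)
  then have "(LINT z|mu_infinity M. h z) = (LINT z|mu_infinity M. h (?a, ?b))"
    using h by (intro integral_cong_AE) (auto simp: measurable_cong_sets[OF sets refl])
  also have "\<dots> = h (?a, ?b)"
    using P.prob_space by (simp add: mu_infinity_def)
  finally show ?thesis .
qed

section \<open>Reduction to the phase marginals\<close>

lemma borel_measurable_fst_snd [measurable]:
  "fst \<in> borel_measurable (borel :: (real \<times> real) measure)"
  "snd \<in> borel_measurable (borel :: (real \<times> real) measure)"
  by (intro borel_measurable_continuous_onI continuous_intros)+

text \<open>The support in time may contain 0, which belongs to \<open>{0..<T}\<close>; it is
  compact because \<open>\<eta>\<close> vanishes after \<open>b < T\<close>.\<close>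

lemma product_in_C01:
  fixes g \<phi> \<eta> :: "real \<Rightarrow> real"
  assumes g: "\<And>x. (g has_real_derivative g' x) (at x)" "continuous_on UNIV g'" "\<And>x. g (x + 2 * pi) = g x"
    and \<phi>: "\<And>x. (\<phi> has_real_derivative \<phi>' x) (at x)" "continuous_on UNIV \<phi>'" "\<And>x. r < \<bar>x\<bar> \<Longrightarrow> \<phi> x = 0"
    and \<eta>: "\<And>x. (\<eta> has_real_derivative \<eta>' x) (at x)" "continuous_on UNIV \<eta>'" "\<And>x. b < x \<Longrightarrow> \<eta> x = 0"
    and "b < T"
  shows "(\<lambda>(\<theta>, \<Omega>, s). g \<theta> * \<phi> \<Omega> * \<eta> s) \<in> C01 T"
proof -
  define f where "f z = g (fst z) * \<phi> (fst (snd z)) * \<eta> (snd (snd z))" for z :: "real \<times> real \<times> real"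
  define f' :: "real \<times> real \<times> real \<Rightarrow> (real \<times> real \<times> real) \<Rightarrow>\<^sub>L real" where "f' z =
      (g' (fst z) * \<phi> (fst (snd z)) * \<eta> (snd (snd z))) *\<^sub>R fst_blinfun
    + (g (fst z) * \<phi>' (fst (snd z)) * \<eta> (snd (snd z))) *\<^sub>R (fst_blinfun o\<^sub>L snd_blinfun)
    + (g (fst z) * \<phi> (fst (snd z)) * \<eta>' (snd (snd z))) *\<^sub>R (snd_blinfun o\<^sub>L snd_blinfun)" for z
  have "continuous_on UNIV g" "continuous_on UNIV \<phi>" "continuous_on UNIV \<eta>"
    using g(1) \<phi>(1) \<eta>(1) by (blast intro: DERIV_imp_continuous_on)+
  note cont = this[THEN continuous_on_compose2] g(2)[THEN continuous_on_compose2]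
    \<phi>(2)[THEN continuous_on_compose2] \<eta>(2)[THEN continuous_on_compose2]
  have 1: "continuous_on (UNIV \<times> UNIV \<times> {0..<T}) f'"
    unfolding f'_def by (intro continuous_intros cont) auto
  have 2: "(f has_derivative blinfun_apply (f' z)) (at z within S)" for z S
    unfolding f_def f'_def
    by (rule derivative_eq_intros DERIV_compose_FDERIV[OF g(1)] DERIV_compose_FDERIV[OF \<phi>(1)]
      DERIV_compose_FDERIV[OF \<eta>(1)] refl)+
      (auto simp: fun_eq_iff blinfun.bilinear_simps algebra_simps)
  have 3: "compact ({-r..r} \<times> {0..b})" "{-r..r} \<times> {0..b} \<subseteq> UNIV \<times> {0..<T}"
    using \<open>b < T\<close> by (auto intro: compact_Times)
  have 4: "f (\<theta>, \<Omega>, s) = 0" if "s \<in> {0..<T}" "(\<Omega>, s) \<notin> {-r..r} \<times> {0..b}" for \<theta> \<Omega> s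
  proof -
    have "r < \<bar>\<Omega>\<bar> \<or> b < s" using that by auto
    then show ?thesis using \<phi>(3) \<eta>(3) by (auto simp: f_def)
  qed
  have "f \<in> C01 T"
    unfolding C01_def
  proof (intro CollectI conjI)
    show "\<exists>h'. continuous_on (UNIV \<times> UNIV \<times> {0..<T}) h' \<and> (\<forall>z\<in>UNIV \<times> UNIV \<times> {0..<T}.
        (f has_derivative blinfun_apply (h' z)) (at z within UNIV \<times> UNIV \<times> {0..<T}))"
      using 1 2 by (intro exI[of _ f'] conjI ballI)
    show "\<forall>\<theta> \<Omega>. \<forall>s\<in>{0..<T}. f (\<theta> + 2 * pi, \<Omega>, s) = f (\<theta>, \<Omega>, s)"
      by (simp add: f_def g(3))
    show "\<exists>C. compact C \<and> C \<subseteq> UNIV \<times> {0..<T} \<and>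
        (\<forall>\<theta> \<Omega>. \<forall>s\<in>{0..<T}. (\<Omega>, s) \<notin> C \<longrightarrow> f (\<theta>, \<Omega>, s) = 0)"
      using 3 4 by (intro exI[of _ "{-r..r} \<times> {0..b}"] conjI allI ballI impI)
  qed
  also have "f = (\<lambda>(\<theta>, \<Omega>, s). g \<theta> * \<phi> \<Omega> * \<eta> s)"
    by (auto simp: f_def)
  finally show ?thesis .
qed

text \<open>A cut-off in time turns stationary functions into admissible tests. It is constant up to
  time \<open>t\<close>, so it leaves no trace in the identity at \<open>t\<close>.\<close>

lemma weak_equation_product:
  fixes g \<phi> :: "real \<Rightarrow> real"
  assumes sol: "global_measure_valued_solution K \<mu>0 \<mu>"
    and g: "\<And>x. (g has_real_derivative g' x) (at x)" "continuous_on UNIV g'" "\<And>x. g (x + 2 * pi) = g x"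
    and \<phi>: "\<And>x. (\<phi> has_real_derivative \<phi>' x) (at x)" "continuous_on UNIV \<phi>'" "\<And>x. r < \<bar>x\<bar> \<Longrightarrow> \<phi> x = 0"
    and "0 \<le> t"
  shows "(LINT z|\<mu> t. g (fst z) * \<phi> (snd z)) - (LINT z|\<mu>0. g (fst z) * \<phi> (snd z)) =
    (LBINT s=0..t. (LINT z|\<mu> s. velocity K (\<mu> s) (fst z) (snd z) * (g' (fst z) * \<phi> (snd z))))"
proof -
  define T where "T = t + 2"
  \<comment> \<open>\<open>\<eta>\<close> is 1 up to \<open>t\<close> and 0 from
    \<open>t + 1\<close> on, before the final time \<open>T = t + 2\<close>.\<close>
  define \<eta> where "\<eta> s = pos_sq (1 - pos_sq (s - t))" for s
  define \<eta>' where "\<eta>' s = - (4 * max 0 (1 - pos_sq (s - t)) * max 0 (s - t))" for s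
  have \<eta>_deriv: "(\<eta> has_real_derivative \<eta>' s) (at s)" for s
    unfolding \<eta>_def \<eta>'_def by (auto intro!: derivative_eq_intros)
  have \<eta>_cont: "continuous_on UNIV \<eta>'"
    unfolding \<eta>'_def by (intro continuous_intros)
  have \<eta>_zero: "\<eta> s = 0" if "t + 1 < s" for s
  proof -
    have "1\<^sup>2 \<le> (s - t)\<^sup>2" using that by (intro power_mono) auto
    then have "1 \<le> pos_sq (s - t)" using that by (simp add: pos_sq_def)
    then show ?thesis by (simp add: \<eta>_def)
  qed
  have \<eta>_one: "\<eta> s = 1" if "s \<le> t" for s
    using that by (simp add: \<eta>_def) (simp add: pos_sq_def)
  define h :: "real \<times> real \<times> real \<Rightarrow> real" where "h = (\<lambda>(\<theta>, \<Omega>, s). g \<theta> * \<phi> \<Omega> * \<eta> s)"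
  have "h \<in> C01 T"
    unfolding h_def T_def
    by (rule product_in_C01[where r = r and b = "t + 1", OF g \<phi> \<eta>_deriv \<eta>_cont \<eta>_zero]) simp_all
  moreover have "measure_valued_solution K T \<mu>0 \<mu>" "t \<in> {0..<T}"
    using sol \<open>0 \<le> t\<close> by (auto simp: global_measure_valued_solution_def T_def)
  ultimately have eq: "(LINT (\<theta>, \<Omega>)|\<mu> t. h (\<theta>, \<Omega>, t)) - (LINT (\<theta>, \<Omega>)|\<mu>0. h (\<theta>, \<Omega>, 0)) =
        (LBINT s=0..t. (LINT (\<theta>, \<Omega>)|\<mu> s.
           d_time T h \<theta> \<Omega> s + velocity K (\<mu> s) \<theta> \<Omega> * d_theta h \<theta> \<Omega> s))"
    unfolding measure_valued_solution_def by blast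
  have dtheta: "d_theta h \<theta> \<Omega> s = g' \<theta> * \<phi> \<Omega>" if "s \<le> t" for \<theta> \<Omega> s
    unfolding d_theta_def h_def using that
    by (intro vector_derivative_at, subst has_real_derivative_iff_has_vector_derivative[symmetric])
      (auto intro!: derivative_eq_intros g(1) simp: \<eta>_one)
  \<comment> \<open>Inner times suffice, because the interval integral ignores its endpoints; this
    avoids the one-sided derivative at time 0.\<close>
  have dtime: "d_time T h \<theta> \<Omega> s = 0" if "0 < s" "s < t" for \<theta> \<Omega> s
  proof -
    have "at s within {0..<T} = at s"
      using that by (intro at_within_interior) (auto simp: T_def interior_atLeastLessThan)
    moreover have "((\<lambda>r. h (\<theta>, \<Omega>, r)) has_real_derivative 0) (at s)"
      unfolding h_def using that
      by (auto intro!: derivative_eq_intros \<eta>_deriv simp: \<eta>'_def)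
    ultimately show ?thesis
      unfolding d_time_def by (simp add: vector_derivative_at has_real_derivative_iff_has_vector_derivative)
  qed
  have "(LBINT s=0..t. (LINT (\<theta>, \<Omega>)|\<mu> s.
           d_time T h \<theta> \<Omega> s + velocity K (\<mu> s) \<theta> \<Omega> * d_theta h \<theta> \<Omega> s)) =
      (LBINT s=0..t. (LINT z|\<mu> s. velocity K (\<mu> s) (fst z) (snd z) * (g' (fst z) * \<phi> (snd z))))"
  proof (rule interval_integral_cong)
    fix s assume "s \<in> einterval (min 0 (ereal t)) (max 0 (ereal t))"
    then have "0 < s" "s < t"
      using \<open>0 \<le> t\<close> by (auto simp: einterval_def min_def max_def split: if_splits)
    then show "(LINT (\<theta>, \<Omega>)|\<mu> s.
           d_time T h \<theta> \<Omega> s + velocity K (\<mu> s) \<theta> \<Omega> * d_theta h \<theta> \<Omega> s) =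
       (LINT z|\<mu> s. velocity K (\<mu> s) (fst z) (snd z) * (g' (fst z) * \<phi> (snd z)))"
      by (simp add: dtime dtheta case_prod_beta')
  qed
  then show ?thesis
    using eq \<open>0 \<le> t\<close> by (simp add: h_def \<eta>_one case_prod_beta')
qed

text \<open>A frequency cut-off of compact support. Its value 1 at the origin is what matters, since
  the solution turns out to be carried by frequency zero.\<close>

definition bump :: "real \<Rightarrow> real" where
  "bump x = pos_sq (1 - x\<^sup>2)"

definition bump' :: "real \<Rightarrow> real" where
  "bump' x = - (4 * x * max 0 (1 - x\<^sup>2))"

lemma bump_deriv: "(bump has_real_derivative bump' x) (at x)"
  unfolding bump_def bump'_def by (auto intro!: derivative_eq_intros)

lemma continuous_on_bump: "continuous_on A bump" "continuous_on A bump'"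
  unfolding bump_def bump'_def by (intro continuous_intros)+

lemma bump_eq_0: "1 < \<bar>x\<bar> \<Longrightarrow> bump x = 0"
  using abs_le_square_iff[of 1 x] by (simp add: bump_def)

lemma bump_0 [simp]: "bump 0 = 1"
  by (simp add: bump_def pos_sq_def)

lemma bump_pos: "\<bar>x\<bar> < 1 \<Longrightarrow> 0 < bump x"
  using abs_square_less_1[of x] by (auto simp: bump_def pos_sq_def)

section \<open>Conservation of the mass and of the frequency\<close>

locale kinetic_kuramoto =
  fixes K :: real and \<mu>0 :: "(real \<times> real) measure" and \<mu> :: "real \<Rightarrow> (real \<times> real) measure"
  assumes K_pos: "0 < K" and radon0: "\<mu>0 \<in> radon_measures" and prob0: "prob_space \<mu>0"
    and AE_snd0: "AE z in \<mu>0. snd z = 0"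
    and sol: "global_measure_valued_solution K \<mu>0 \<mu>"
begin

lemma radon: "0 \<le> t \<Longrightarrow> \<mu> t \<in> radon_measures"
  using sol[unfolded global_measure_valued_solution_def, rule_format, of "t + 1"]
  by (auto simp: measure_valued_solution_def)

text \<open>With a test constant in the phase the transport term drops out, so the integral keeps
  its initial value.\<close>

lemma frequency_marginal:
  assumes \<phi>: "\<And>x. (\<phi> has_real_derivative \<phi>' x) (at x)" "continuous_on UNIV \<phi>'" "\<And>x. r < \<bar>x\<bar> \<Longrightarrow> \<phi> x = 0"
    and "0 \<le> t"
  shows "(LINT z|\<mu> t. \<phi> (snd z)) = \<phi> 0"
proof -
  have "(LINT z|\<mu> t. 1 * \<phi> (snd z)) - (LINT z|\<mu>0. 1 * \<phi> (snd z)) = (LBINT s=0..t. 0)"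
    using weak_equation_product[OF sol _ _ _ \<phi> \<open>0 \<le> t\<close>, of "\<lambda>_. 1" "\<lambda>_. 0"] by simp
  moreover have "(LINT z|\<mu>0. \<phi> (snd z)) = (LINT z|\<mu>0. \<phi> 0)"
  proof (rule integral_cong_AE)
    have [measurable]: "\<phi> \<in> borel_measurable borel"
      by (intro borel_measurable_continuous_onI DERIV_imp_continuous_on[OF \<phi>(1)])
    show "(\<lambda>z. \<phi> (snd z)) \<in> borel_measurable \<mu>0"
      by (intro radon_measurable[OF radon0]) measurable
    show "AE z in \<mu>0. \<phi> (snd z) = \<phi> 0" using AE_snd0 by eventually_elim simp
  qed simp
  ultimately show ?thesis using prob_space.prob_space[OF prob0] by simp
qed

lemma AE_snd:
  assumes "0 \<le> t"
  shows "AE z in \<mu> t. snd z = 0"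
proof -
  \<comment> \<open>The test is nonnegative and vanishes at frequency 0, so its integral is zero and
    it vanishes almost everywhere. The bump is positive for frequencies below \<open>Suc n\<close>
    in modulus; all \<open>n\<close> together reach every frequency.\<close>
  have "AE z in \<mu> t. (snd z)\<^sup>2 * bump (snd z / real (Suc n)) = 0" for n
  proof -
    define N where "N = real (Suc n)"
    have N: "0 < N" by (simp add: N_def)
    define \<phi> where "\<phi> x = x\<^sup>2 * bump (x / N)" for x
    define \<phi>' where "\<phi>' x = 2 * x * bump (x / N) + x\<^sup>2 * (bump' (x / N) / N)" for x
    have 1: "(\<phi> has_real_derivative \<phi>' x) (at x)" for x
      unfolding \<phi>_def \<phi>'_def using N
      by (auto intro!: derivative_eq_intros DERIV_chain2[OF bump_deriv])
    have 2: "continuous_on UNIV \<phi>'"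
      unfolding \<phi>'_def using N
      by (intro continuous_intros continuous_on_bump[THEN continuous_on_compose2]) auto
    have 3: "\<phi> x = 0" if "N < \<bar>x\<bar>" for x
      using that N by (simp add: \<phi>_def bump_eq_0)
    have cont: "continuous_on UNIV (\<lambda>z. \<phi> (snd z))"
      unfolding \<phi>_def using N
      by (intro continuous_intros continuous_on_bump[THEN continuous_on_compose2]) auto
    have "(LINT z|\<mu> t. \<phi> (snd z)) = 0"
      using frequency_marginal[OF 1 2 3 assms] by (simp add: \<phi>_def)
    moreover have "integrable (\<mu> t) (\<lambda>z. \<phi> (snd z))"
      using cont 3 by (rule radon_integrable[OF radon[OF assms]])
    ultimately show ?thesis
      by (subst (asm) integral_nonneg_eq_0_iff_AE) (auto simp: \<phi>_def bump_def N_def)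
  qed
  then have "AE z in \<mu> t. \<forall>n. (snd z)\<^sup>2 * bump (snd z / real (Suc n)) = 0"
    unfolding AE_all_countable by blast
  then show ?thesis
  proof eventually_elim
    case (elim z)
    obtain n where "\<bar>snd z\<bar> < real n" using reals_Archimedean2 by blast
    then have "0 < bump (snd z / real (Suc n))" by (intro bump_pos) simp
    then show ?case using spec[OF elim, of n] by simp
  qed
qed

lemma prob_mu:
  assumes "0 \<le> t"
  shows "prob_space (\<mu> t)"
proof -
  have "(LINT z|\<mu> t. bump (snd z)) = (LINT z|\<mu> t. 1)"
  proof (rule integral_cong_AE)
    show "(\<lambda>z. bump (snd z)) \<in> borel_measurable (\<mu> t)"
      by (intro radon_measurable[OF radon[OF assms]] borel_measurable_continuous_onI
        continuous_on_bump(1)[THEN continuous_on_compose2] continuous_intros) auto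
    show "AE z in \<mu> t. bump (snd z) = 1"
      using AE_snd[OF assms] by eventually_elim simp
  qed simp
  moreover have "(LINT z|\<mu> t. bump (snd z)) = 1"
    using frequency_marginal[OF bump_deriv continuous_on_bump(2) bump_eq_0 assms] by simp
  \<comment> \<open>\<open>measure\<close> is 0 by convention when the mass is infinite, so the
    value 1 includes finiteness.\<close>
  ultimately have "measure (\<mu> t) (space (\<mu> t)) = 1" by simp
  then show ?thesis
    by (intro prob_spaceI) (metis emeasure_eq_ennreal_measure ennreal_1 measure_zero_top zero_neq_one)
qed

lemma velocity_eq:
  assumes "0 \<le> t"
  shows "velocity K (\<mu> t) \<theta> \<Omega> =
    \<Omega> - K * (sin \<theta> * (LINT w|\<mu> t. cos (fst w)) - cos \<theta> * (LINT w|\<mu> t. sin (fst w)))"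
proof -
  interpret prob_space "\<mu> t" using prob_mu[OF assms] .
  have "integrable (\<mu> t) (\<lambda>w. cos (fst w))" "integrable (\<mu> t) (\<lambda>w. sin (fst w))"
    by (intro integrable_const_bound[where B = 1] radon_measurable[OF radon[OF assms]]; simp)+
  then show ?thesis by (simp add: velocity_def sin_diff)
qed

text \<open>The factor \<open>bump\<close> makes a function of the phase compactly supported in
  frequency, hence usable as a test, without changing its integral.\<close>

lemma LINT_bump:
  assumes M: "M \<in> radon_measures" "AE z in M. snd z = 0" and g: "continuous_on UNIV g"
  shows "(LINT z|M. g (fst z) * bump (snd z)) = (LINT x|distr M borel fst. g x)"
proof -
  have [measurable]: "g \<in> borel_measurable borel"
    using g by (rule borel_measurable_continuous_onI)
  have [measurable]: "bump \<in> borel_measurable borel"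
    by (rule borel_measurable_continuous_onI[OF continuous_on_bump(1)])
  have "(LINT z|M. g (fst z) * bump (snd z)) = (LINT z|M. g (fst z))"
  proof (rule integral_cong_AE)
    show "AE z in M. g (fst z) * bump (snd z) = g (fst z)"
      using M(2) by eventually_elim simp
  qed (intro radon_measurable[OF M(1)]; measurable)+
  also have "\<dots> = (LINT x|distr M borel fst. g x)"
    by (intro integral_distr[symmetric] radon_measurable[OF M(1)]; measurable)
  finally show ?thesis .
qed

sublocale phase: identical_oscillators K "distr \<mu>0 borel fst" "\<lambda>t. distr (\<mu> t) borel fst"
proof (rule identical_oscillators.intro)
  have circle: "AE x in distr M borel fst. x \<in> circle" if M: "M \<in> radon_measures" for M
  proof (subst AE_distr_iff)
    show "AE z in M. fst z \<in> circle"
      by (intro AE_I2) (auto simp: radon_space[OF M] phase_space_def)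
  qed (use borel_measurable_fst_snd in \<open>auto intro!: radon_measurable[OF M] simp: circle_def\<close>)
  show "0 < K" by (rule K_pos)
  show "prob_space (distr \<mu>0 borel fst)"
    by (intro prob_space.prob_space_distr prob0 radon_measurable[OF radon0]) measurable
  show "AE x in distr \<mu>0 borel fst. x \<in> circle" by (rule circle[OF radon0])
  show "prob_space (distr (\<mu> t) borel fst)" if "0 \<le> t" for t
    by (intro prob_space.prob_space_distr prob_mu that radon_measurable[OF radon]) measurable
  show "AE x in distr (\<mu> t) borel fst. x \<in> circle" if "0 \<le> t" for t
    by (rule circle[OF radon[OF that]])
  show "continuous_on {0..} (\<lambda>t. LINT x|distr (\<mu> t) borel fst. g x)"
    if g: "continuous_on UNIV g" "\<And>x. g (x + 2 * pi) = g x" for g :: "real \<Rightarrow> real"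
  proof -
    have "(\<lambda>z. g (fst z) * bump (snd z)) \<in> C0"
      unfolding C0_def
    proof (intro CollectI conjI)
      show "continuous_on UNIV (\<lambda>z :: real \<times> real. g (fst z) * bump (snd z))"
        by (intro continuous_intros continuous_on_compose2[OF g(1)]
          continuous_on_compose2[OF continuous_on_bump(1)]) auto
      have "bump \<Omega> = 0" if "\<Omega> \<notin> {-1..1}" for \<Omega>
        using that by (intro bump_eq_0) auto
      then show "\<exists>C. compact C \<and> (\<forall>\<theta> \<Omega>. \<Omega> \<notin> C \<longrightarrow> g (fst (\<theta>, \<Omega>)) * bump (snd (\<theta>, \<Omega>)) = 0)"
        by (intro exI[of _ "{-1..1}"]) auto
    qed (simp add: g)
    then have cont: "continuous_on {0..<T} (\<lambda>t. LINT z|\<mu> t. g (fst z) * bump (snd z))" if "0 < T" for T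
      using sol that unfolding global_measure_valued_solution_def measure_valued_solution_def by blast
    \<comment> \<open>Continuity is local, and each \<open>t\<close> lies in
      \<open>{0..<t + 1}\<close>.\<close>
    have "continuous_on {0..} (\<lambda>t. LINT z|\<mu> t. g (fst z) * bump (snd z))"
      unfolding continuous_on_eq_continuous_within
    proof
      fix t :: real assume "t \<in> {0..}"
      moreover have "at t within {0..} = at t within {0..<t + 1}"
        by (rule at_within_nhd[where S = "{..<t + 1}"]) auto
      ultimately show "continuous (at t within {0..}) (\<lambda>t. LINT z|\<mu> t. g (fst z) * bump (snd z))"
        using cont[of "t + 1"] by (simp add: continuous_on_eq_continuous_within)
    qed
    then show ?thesis
      by (rule continuous_on_eq) (simp add: LINT_bump[OF radon AE_snd g(1)])
  qed
  show "(LINT x|distr (\<mu> t) borel fst. g x) - (LINT x|distr \<mu>0 borel fst. g x) =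
      (LBINT s=0..t. (LINT x|distr (\<mu> s) borel fst.
        - K * (LINT y|distr (\<mu> s) borel fst. sin (x - y)) * g' x))"
    if g: "\<And>x. (g has_real_derivative g' x) (at x)" "continuous_on UNIV g'"
      "\<And>x. g (x + 2 * pi) = g x" and "0 \<le> t" for g g' t
  proof -
    have cont_g: "continuous_on UNIV g"
      using g(1) by (rule DERIV_imp_continuous_on)
    have "(LINT z|\<mu> s. velocity K (\<mu> s) (fst z) (snd z) * (g' (fst z) * bump (snd z))) =
        (LINT x|distr (\<mu> s) borel fst. - K * (LINT y|distr (\<mu> s) borel fst. sin (x - y)) * g' x)"
      if s: "0 \<le> s" for s
    proof -
      note M = radon[OF s]
      \<comment> \<open>At frequency zero the velocity is a function of the phase alone.\<close>
      have v: "- K * (LINT y|distr (\<mu> s) borel fst. sin (x - y)) = velocity K (\<mu> s) x 0" for x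
        by (subst integral_distr) (auto intro!: radon_measurable[OF M] borel_measurable_fst_snd simp: velocity_def)
      have v_cont: "continuous_on UNIV (\<lambda>x. velocity K (\<mu> s) x 0 * g' x)"
        unfolding velocity_eq[OF s] by (intro continuous_intros g(2))
      have [measurable]: "g' \<in> borel_measurable borel" "bump \<in> borel_measurable borel"
        using borel_measurable_continuous_onI g(2) continuous_on_bump(1) by blast+
      have "(LINT z|\<mu> s. velocity K (\<mu> s) (fst z) (snd z) * (g' (fst z) * bump (snd z))) =
          (LINT z|\<mu> s. (velocity K (\<mu> s) (fst z) 0 * g' (fst z)) * bump (snd z))"
      proof (rule integral_cong_AE)
        show "AE z in \<mu> s. velocity K (\<mu> s) (fst z) (snd z) * (g' (fst z) * bump (snd z)) =
            velocity K (\<mu> s) (fst z) 0 * g' (fst z) * bump (snd z)"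
          using AE_snd[OF s] by eventually_elim simp
      qed (unfold velocity_eq[OF s], (intro radon_measurable[OF M], measurable)+)
      also have "\<dots> = (LINT x|distr (\<mu> s) borel fst. velocity K (\<mu> s) x 0 * g' x)"
        using LINT_bump[OF M AE_snd[OF s] v_cont] .
      finally show ?thesis by (simp only: v)
    qed
    then have "(LBINT s=0..t. (LINT z|\<mu> s. velocity K (\<mu> s) (fst z) (snd z) * (g' (fst z) * bump (snd z)))) =
        (LBINT s=0..t. (LINT x|distr (\<mu> s) borel fst.
          - K * (LINT y|distr (\<mu> s) borel fst. sin (x - y)) * g' x))"
      using \<open>0 \<le> t\<close> by (intro interval_integral_cong) (auto simp: einterval_def min_def split: if_splits)
    then show ?thesis
      using weak_equation_product[OF sol g bump_deriv continuous_on_bump(2) bump_eq_0 \<open>0 \<le> t\<close>]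
      by (simp only: LINT_bump[OF radon AE_snd cont_g] LINT_bump[OF radon0 AE_snd0 cont_g] \<open>0 \<le> t\<close>)
  qed
qed simp_all

end

section \<open>Convergence from an initial support of diameter less than \<open>pi\<close>\<close>

theorem theorem4p1:
  fixes K :: real
    and \<mu>0 :: "(real \<times> real) measure"
    and \<mu> :: "real \<Rightarrow> (real \<times> real) measure"
  assumes "K > 0"
    and "\<mu>0 \<in> radon_measures" and "prob_space \<mu>0"
    and "\<exists>c. snd ` spt \<mu>0 = {c}" and "Omega_c \<mu>0 = 0"
    and "theta_c \<mu>0 = pi" and "D_theta \<mu>0 < pi"
    and "global_measure_valued_solution K \<mu>0 \<mu>"
  shows "((\<lambda>t. bounded_lipschitz_dist (\<mu> t) (mu_infinity \<mu>0)) \<longlongrightarrow> 0) at_top"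
proof -
  interpret M0: prob_space \<mu>0 by fact
  note radon0 = \<open>\<mu>0 \<in> radon_measures\<close>
  have fst_meas: "fst \<in> borel_measurable \<mu>0" and snd_meas: "snd \<in> borel_measurable \<mu>0"
    by (intro radon_measurable[OF radon0] borel_measurable_fst_snd)+
  note spt = AE_spt[OF radon0]
  obtain \<Omega>0 where \<Omega>0: "snd ` spt \<mu>0 = {\<Omega>0}" using assms(4) by blast
  have snd_eq: "AE z in \<mu>0. snd z = \<Omega>0"
    using spt by eventually_elim (use \<Omega>0 in auto)
  \<comment> \<open>The common frequency equals its mean, which is 0.\<close>
  have "Omega_c \<mu>0 = (LINT z|\<mu>0. \<Omega>0)"
    unfolding Omega_c_def using snd_eq snd_meas by (intro integral_cong_AE) auto
  then have "\<Omega>0 = 0" using assms(5) M0.prob_space by simp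
  then have AE_snd0: "AE z in \<mu>0. snd z = 0" using snd_eq by simp
  interpret kinetic_kuramoto K \<mu>0 \<mu>
    using assms AE_snd0 by (intro kinetic_kuramoto.intro)
  define S where "S = fst ` spt \<mu>0"
  have S_circle: "S \<subseteq> {0..<2 * pi}"
    by (auto simp: S_def spt_def phase_space_def circle_def)
  have S_ne: "S \<noteq> {}" using \<Omega>0 by (auto simp: S_def)
  have "bounded S" using S_circle by (rule bounded_subset[rotated]) simp
  then have S_diam: "\<bar>x - y\<bar> \<le> D_theta \<mu>0" if "x \<in> S" "y \<in> S" for x y
    using diameter_bounded_bound[of S x y] that by (simp add: D_theta_def S_def dist_real_def)
  define D where "D = D_theta \<mu>0"
  \<comment> \<open>Midpoint of the smallest closed interval containing the phases of the support;
    its half-width is at most \<open>D / 2\<close>.\<close>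
  define c where "c = (Inf S + Sup S) / 2"
  have bdd: "bdd_above S" "bdd_below S"
    using \<open>bounded S\<close> by (auto intro: bounded_imp_bdd_above bounded_imp_bdd_below)
  have "Sup S \<le> Inf S + D"
  proof (rule cSup_least[OF S_ne])
    fix x assume x: "x \<in> S"
    have "x - D \<le> Inf S"
    proof (rule cInf_greatest[OF S_ne])
      fix y assume "y \<in> S"
      from S_diam[OF x this] show "x - D \<le> y" by (simp add: D_def abs_le_iff)
    qed
    then show "x \<le> Inf S + D" by simp
  qed
  then have S_c: "\<bar>x - c\<bar> \<le> D / 2" if "x \<in> S" for x
    using cSup_upper[OF that bdd(1)] cInf_lower[OF that bdd(2)] unfolding c_def abs_le_iff by (simp add: field_simps)
  have AE_c: "AE z in \<mu>0. \<bar>fst z - c\<bar> \<le> D / 2"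
    using spt by eventually_elim (rule S_c, simp add: S_def)
  have int_fst: "integrable \<mu>0 fst"
    using fst_meas by (intro M0.integrable_const_bound[where B = "2 * pi"] AE_I2)
      (auto simp: radon_space[OF radon0] phase_space_def circle_def)
  \<comment> \<open>The mean \<open>pi\<close> is an average of points within \<open>D / 2\<close>
    of \<open>c\<close>.\<close>
  have "\<bar>c - pi\<bar> \<le> D / 2"
  proof -
    have "pi - c = (LINT z|\<mu>0. fst z - c)"
      using int_fst assms(6) M0.prob_space by (simp add: theta_c_def)
    also have "\<bar>\<dots>\<bar> \<le> (LINT z|\<mu>0. \<bar>fst z - c\<bar>)" by (rule integral_abs_bound)
    also have "\<dots> \<le> (LINT z|\<mu>0. D / 2)"
      using int_fst AE_c by (intro integral_mono_AE) auto
    finally show ?thesis using M0.prob_space by (simp add: abs_minus_commute)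
  qed
  \<comment> \<open>Halfway between \<open>D / 2\<close> and \<open>pi / 2\<close>, hence positive
    even if the support has a single phase.\<close>
  define \<delta> where "\<delta> = (D + pi) / 4"
  obtain x where "x \<in> S" using S_ne by blast
  then have "0 \<le> D" using S_diam[of x x] by (simp add: D_def)
  moreover have "D < pi" using assms(7) by (simp add: D_def)
  ultimately have \<delta>: "0 < \<delta>" "\<delta> < pi / 2" "D / 2 \<le> \<delta>"
    using pi_gt_zero by (auto simp: \<delta>_def)
  have "((\<lambda>t. LINT x|distr (\<mu> t) borel fst. \<bar>x - pi\<bar>) \<longlongrightarrow> 0) at_top"
  proof (rule phase.concentration)
    show "\<bar>c - pi\<bar> \<le> \<delta>" using \<open>\<bar>c - pi\<bar> \<le> D / 2\<close> \<delta> by linarith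
    show "AE x in distr \<mu>0 borel fst. \<bar>x - c\<bar> \<le> \<delta>"
    proof (subst AE_distr_iff[OF fst_meas])
      show "AE z in \<mu>0. \<bar>fst z - c\<bar> \<le> \<delta>"
        using AE_c by eventually_elim (use \<delta> in linarith)
    qed simp
    show "(LINT x|distr \<mu>0 borel fst. x) = pi"
      using assms(6) by (subst integral_distr[OF fst_meas]) (auto simp: theta_c_def)
  qed (use \<delta> in auto)
  then show ?thesis
  proof (rule bounded_lipschitz_dist_tendsto_0[where Z = "(pi, 0)", rotated])
    show "(pi, 0) \<in> phase_space" by (simp add: phase_space_def circle_def)
    show "(LINT z|mu_infinity \<mu>0. h z) = h (pi, 0)"
      if "h \<in> borel_measurable (restrict_space borel phase_space)" for h :: "real \<times> real \<Rightarrow> real"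
      using integral_mu_infinity[OF _ that, of \<mu>0] assms(5,6) by (simp add: circle_def)
    show "\<forall>\<^sub>F t in at_top. \<mu> t \<in> radon_measures \<and> prob_space (\<mu> t) \<and>
        integrable (\<mu> t) (\<lambda>z. dist z (pi, 0)) \<and>
        (LINT z|\<mu> t. dist z (pi, 0)) \<le> (LINT x|distr (\<mu> t) borel fst. \<bar>x - pi\<bar>)"
      using eventually_ge_at_top[of 0]
    proof eventually_elim
      case (elim t)
      have meas: "(\<lambda>z. dist z (pi, 0)) \<in> borel_measurable (\<mu> t)" "(\<lambda>z. \<bar>fst z - pi\<bar>) \<in> borel_measurable (\<mu> t)"
        by (intro radon_measurable[OF radon[OF elim]]; measurable)+
      have eq: "AE z in \<mu> t. dist z (pi, 0) = \<bar>fst z - pi\<bar>"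
        using AE_snd[OF elim] by eventually_elim (auto simp: dist_prod_def dist_real_def)
      interpret prob_space "\<mu> t" using prob_mu[OF elim] .
      have "integrable (\<mu> t) (\<lambda>z. \<bar>fst z - pi\<bar>)"
        using meas(2) by (intro integrable_const_bound[where B = pi] AE_I2)
          (auto simp: radon_space[OF radon[OF elim]] phase_space_def circle_def)
      then have "integrable (\<mu> t) (\<lambda>z. dist z (pi, 0))"
        using integrable_cong_AE[OF meas eq] by simp
      moreover have "(LINT x|distr (\<mu> t) borel fst. \<bar>x - pi\<bar>) = (LINT z|\<mu> t. \<bar>fst z - pi\<bar>)"
        by (intro integral_distr radon_measurable[OF radon[OF elim]]; measurable)
      ultimately show ?case
        using radon[OF elim] prob_mu[OF elim] integral_cong_AE[OF meas eq] by simp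
    qed
  qed
qed

end
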